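(* Let $\tau\in\mathbb{H}$ be such that $q=e^{\pi i\tau}$ is an algebraic number. Let $\ell,m,n\geq 1$ be integers. Then the three numbers $\theta_3(\ell\tau)$, $\theta_3(m\tau)$, $\theta_3(n\tau)$ are algebraically dependent over $\mathbb{Q}$.
   Context: $\mathbb{H}=\{\tau\in\mathbb{C}:\Im(\tau)>0\}$. For $\tau\in\mathbb{H}$ put $q=e^{\pi i\tau}$ and $\theta_3(\tau)=1+2\sum_{\nu=1}^{\infty}q^{\nu^2}$. *)

theory Defs
  imports "HOL-Analysis.Analysis" "HOL-Computational_Algebra.Polynomial"
begin

definition nome :: "complex \<Rightarrow> complex" where
  "nome \<tau> = exp (of_real pi * \<i> * \<tau>)"

definition theta3 :: "complex \<Rightarrow> complex" where
  "theta3 \<tau> = 1 + 2 * (\<Sum>\<nu>. nome \<tau> ^ ((Suc \<nu>)\<^sup>2))"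

text \<open>Evaluation of a trivariate polynomial with rational coefficients, represented
  as an element of Q[Z][Y][X] (isomorphic to Q[X,Y,Z]), at (x,y,z).\<close>
definition eval3 :: "rat poly poly poly \<Rightarrow> complex \<Rightarrow> complex \<Rightarrow> complex \<Rightarrow> complex" where
  "eval3 P x y z =
     poly (map_poly (\<lambda>Q. poly (map_poly (\<lambda>R. poly (map_poly of_rat R) z) Q) y) P) x"

definition alg_dependent3 :: "complex \<Rightarrow> complex \<Rightarrow> complex \<Rightarrow> bool" where
  "alg_dependent3 x y z \<longleftrightarrow> (\<exists>P. P \<noteq> 0 \<and> eval3 P x y z = 0)"

end

theory Submission
  imports Defs "HOL-Complex_Analysis.Complex_Analysis" "HOL-Real_Asymp.Real_Asymp"
begin

text \<open>
  The dependence holds identically in \<open>\<tau>\<close>. The eighth powers of the three Jacobi theta functions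
  are permuted by \<open>SL\<^sub>2(\<int>)\<close> with weight 4, hence so is, for each \<open>L\<close>, the finite set of their
  transforms under integer matrices of determinant \<open>L\<close>, which contains \<open>\<theta>\<^sub>3(L\<tau>)\<^sup>8\<close>. Let \<open>R\<close> be the
  product of the sizes of these sets for \<open>L = \<ell>, m, n\<close>. Substituting their elements into a form of
  degree \<open>d\<close> in three variables gives at most \<open>R\<close> functions permuted with weight \<open>4d\<close>. If one of
  them vanishes to order \<open>t \<ge> 4dR\<close> in \<open>q\<close> at infinity, then the product \<open>G\<close> of the nonzero ones must be
  zero: \<open>|G| Im(\<tau>)\<^sup>K\<^sup>/\<^sup>2\<close> is invariant under \<open>SL\<^sub>2(\<int>)\<close>, and the maximum principle for
  \<open>G q\<^sup>-\<^sup>t\<close> on a half plane bounds its supremum by a proper fraction of itself. So the function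
  vanishing to order \<open>t\<close> is itself zero. As forms of degree \<open>d\<close> have about \<open>d\<^sup>2/2\<close> coefficients and
  the theta series have rational ones, linear algebra over \<open>\<rat>\<close> gives a nonzero form for which
  \<open>\<theta>\<^sub>3(\<ell>\<tau>)\<^sup>8, \<theta>\<^sub>3(m\<tau>)\<^sup>8, \<theta>\<^sub>3(n\<tau>)\<^sup>8\<close> yields such a function once \<open>d \<ge> 8R\<close>.
\<close>

section \<open>The inversion formula on the imaginary axis\<close>

text \<open>Eighth powers serve to clear two multipliers: \<open>\<tau> + 1\<close> scales
  \<open>theta2\<close> by an eighth root of unity, and \<open>-1 / \<tau>\<close> brings in a
  square root of -i \<tau>, whose eighth power is \<open>\<tau> ^ 4\<close>. The analytic input is
  the inversion law of \<open>theta3\<close>. It is obtained on the imaginary axis as a limit of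
  finite trigonometric identities and spread by the identity theorem; the laws of
  \<open>theta2\<close> and \<open>theta4\<close> then follow from theta3(\<tau>) + theta3(\<tau> +
  1) = 2 theta3(4 \<tau>). The transforms form a finite set of functions although infinitely many
  matrices have determinant L: the modular group acting from the left only permutes the three eighth
  powers, so each matrix may be replaced by an upper triangular one with bounded entries. Where a
  valence formula would count zeros, a contraction estimate is used, for which behaviour under the
  two generators and bounds on Im \<tau> \<ge> 1/4 are enough.\<close>

lemma sum_cis_root_of_unity:
  fixes l :: nat and k :: int
  assumes "l > 0"
  shows "(\<Sum>j<l. cis (2 * pi * k * j / l)) = (if int l dvd k then of_nat l else 0)"
proof -
  define z where "z = cis (2 * pi * k / l)"
  have pw: "cis (2 * pi * k * j / l) = z ^ j" for j :: nat
    by (simp add: z_def Complex.DeMoivre mult_ac)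
  have zl: "z ^ l = 1"
  proof -
    have "z ^ l = cis (2 * pi * k)"
      using assms by (simp add: z_def Complex.DeMoivre)
    then show ?thesis by (simp add: complex_eq_iff cos_int_2pin sin_int_2pin)
  qed
  show ?thesis
  proof (cases "int l dvd k")
    case True
    then obtain c where c: "k = int l * c" by (elim dvdE)
    have "z = cis (2 * pi * c)" using assms by (simp add: z_def c field_simps)
    then have "z = 1" by (simp add: complex_eq_iff cos_int_2pin sin_int_2pin)
    then show ?thesis using True by (simp add: pw)
  next
    case False
    have "z \<noteq> 1"
    proof
      assume "z = 1"
      then have "cos (2 * pi * k / l) = 1" by (simp add: z_def complex_eq_iff)
      then obtain c :: int where "2 * pi * k / l = of_int c * 2 * pi"
        using cos_one_2pi_int by blast
      then have "of_int k = (of_int (c * int l) :: real)"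
        using assms by (simp add: field_simps)
      then have "k = c * int l" by (simp only: of_int_eq_iff)
      then show False using False by simp
    qed
    then show ?thesis using False by (simp add: pw geometric_sum zl)
  qed
qed

lemma two_cos_power_even:
  "complex_of_real ((2 * cos x) ^ (2 * m)) =
     (\<Sum>r\<le>2*m. of_nat (2 * m choose r) * cis (2 * (real r - real m) * x))"
proof -
  have "complex_of_real (2 * cos x) = cis x + cis (-x)"
    by (simp add: complex_eq_iff)
  then have "complex_of_real ((2 * cos x) ^ (2 * m)) = (cis x + cis (-x)) ^ (2 * m)"
    by (simp only: of_real_power)
  also have "\<dots> = (\<Sum>r\<le>2*m. of_nat (2 * m choose r) * cis x ^ r * cis (-x) ^ (2 * m - r))"
    by (rule binomial_ring)
  also have "\<dots> = (\<Sum>r\<le>2*m. of_nat (2 * m choose r) * cis (2 * (real r - real m) * x))"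
    by (intro sum.cong refl) (simp add: Complex.DeMoivre cis_mult of_nat_diff algebra_simps)
  finally show ?thesis .
qed

text \<open>The frequencies of \<open>(2 * cos x) ^ (2 * m)\<close> are the even numbers 2(r - m),
  so the points x = pi k / l already run through all l-th roots of unity; orthogonality then keeps r
  congruent to m modulo l.\<close>

lemma sum_cos_power_even:
  assumes "l > 0"
  shows "(\<Sum>k<l. (2 * cos (pi * real k / real l)) ^ (2 * m)) =
           real l * (\<Sum>r | r \<le> 2 * m \<and> int l dvd int r - int m. real (2 * m choose r))"
proof -
  have "complex_of_real (\<Sum>k<l. (2 * cos (pi * real k / real l)) ^ (2 * m)) =
     (\<Sum>k<l. \<Sum>r\<le>2*m. of_nat (2 * m choose r) * cis (2 * (real r - real m) * (pi * real k / real l)))"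
    by (simp only: of_real_sum two_cos_power_even)
  also have "\<dots> = (\<Sum>r\<le>2*m. of_nat (2 * m choose r) *
                 (\<Sum>k<l. cis (2 * pi * of_int (int r - int m) * real k / real l)))"
    by (subst sum.swap) (simp add: sum_distrib_left algebra_simps diff_divide_distrib)
  also have "\<dots> = (\<Sum>r\<le>2*m. if int l dvd int r - int m then of_nat (2 * m choose r) * of_nat l else 0)"
    by (intro sum.cong refl, subst sum_cis_root_of_unity[OF assms]) simp
  also have "\<dots> = of_real (real l * (\<Sum>r | r \<le> 2 * m \<and> int l dvd int r - int m. real (2 * m choose r)))"
    by (subst sum.inter_filter [symmetric]) (auto simp: sum_distrib_left mult_ac)
  finally show ?thesis by (simp only: of_real_eq_iff)
qed

text \<open>Writing r = m + l c isolates c = 0, and the symmetry of binomial coefficients pairs c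
  with -c. This produces the shape 1 + 2(...) of the theta series.\<close>

lemma sum_binomial_residue_class:
  assumes "l > 0"
  shows "(\<Sum>r | r \<le> 2 * m \<and> int l dvd int r - int m. real (2 * m choose r)) =
           real (2 * m choose m) + 2 * (\<Sum>j | l * Suc j \<le> m. real (2 * m choose (m + l * Suc j)))"
proof -
  let ?J = "{j. l * Suc j \<le> m}"
  have fin: "finite ?J"
  proof (rule finite_subset)
    show "?J \<subseteq> {..m}"
    proof
      fix j assume "j \<in> ?J"
      moreover have "1 * Suc j \<le> l * Suc j" using assms by (intro mult_right_mono) auto
      ultimately show "j \<in> {..m}" by simp
    qed
  qed simp
  have eq: "{r. r \<le> 2 * m \<and> int l dvd int r - int m} =
      insert m ((\<lambda>j. m + l * Suc j) ` ?J \<union> (\<lambda>j. m - l * Suc j) ` ?J)" (is "?L = ?R")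
  proof (intro equalityI subsetI)
    fix r assume "r \<in> ?L"
    then have r: "r \<le> 2 * m" "int l dvd int r - int m" by auto
    then obtain c where c: "int r - int m = int l * c" by (elim dvdE)
    consider "c = 0" | "c > 0" | "c < 0" by linarith
    then show "r \<in> ?R"
    proof cases
      case 1 then show ?thesis using c by simp
    next
      case 2
      then obtain j where j: "c = int (Suc j)" by (metis gr0_implies_Suc pos_int_cases)
      have "int r = int (m + l * Suc j)" using c j by (simp add: algebra_simps)
      then have "r = m + l * Suc j" by (simp only: of_nat_eq_iff)
      then show ?thesis using r by auto
    next
      case 3
      then obtain j where j: "c = - int (Suc j)" by (metis gr0_implies_Suc neg_int_cases)
      have "int m = int (r + l * Suc j)" using c j by (simp add: algebra_simps)
      then have "m = r + l * Suc j" by (simp only: of_nat_eq_iff)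
      then have "j \<in> ?J" "r = m - l * Suc j" by auto
      then show ?thesis by blast
    qed
  next
    fix r assume "r \<in> ?R"
    then consider "r = m" | j where "j \<in> ?J" "r = m + l * Suc j" | j where "j \<in> ?J" "r = m - l * Suc j"
      by auto
    then show "r \<in> ?L"
    proof cases
      case 1 then show ?thesis by simp
    next
      case (2 j)
      have "int r - int m = int l * int (Suc j)" unfolding 2(2) of_nat_add of_nat_mult by linarith
      then have "int l dvd int r - int m" by (rule dvdI)
      then show ?thesis using 2 by simp
    next
      case (3 j)
      have le: "l * Suc j \<le> m" using 3 by simp
      have "int r - int m = int l * (- int (Suc j))"
        unfolding 3(2) of_nat_diff[OF le] of_nat_mult by (simp add: algebra_simps)
      then have "int l dvd int r - int m" by (rule dvdI)
      then show ?thesis using 3 by simp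
    qed
  qed
  have inj1: "inj_on (\<lambda>j. m + l * Suc j) ?J" using assms by (auto simp: inj_on_def)
  have inj2: "inj_on (\<lambda>j. m - l * Suc j) ?J"
  proof (rule inj_onI)
    fix i j assume ij: "i \<in> ?J" "j \<in> ?J" "m - l * Suc i = m - l * Suc j"
    then have "l * Suc i = l * Suc j" by (metis (mono_tags) diff_diff_cancel mem_Collect_eq)
    then show "i = j" using assms by (metis Suc_inject mult_cancel1 not_gr0)
  qed
  have pos: "l * Suc j > 0" for j using assms by simp
  have disj: "(\<lambda>j. m + l * Suc j) ` ?J \<inter> (\<lambda>j. m - l * Suc j) ` ?J = {}"
  proof (rule ccontr)
    assume "\<not> ?thesis"
    then obtain i j where "j \<in> ?J" "m + l * Suc i = m - l * Suc j" by blast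
    then show False using pos[of i] pos[of j] by linarith
  qed
  have notin: "m \<notin> (\<lambda>j. m + l * Suc j) ` ?J \<union> (\<lambda>j. m - l * Suc j) ` ?J"
  proof
    assume "m \<in> (\<lambda>j. m + l * Suc j) ` ?J \<union> (\<lambda>j. m - l * Suc j) ` ?J"
    then obtain j where "j \<in> ?J" "m = m + l * Suc j \<or> m = m - l * Suc j" by blast
    then show False using pos[of j] by (simp only: mem_Collect_eq) linarith
  qed
  have sym: "2 * m choose (m - l * Suc j) = 2 * m choose (m + l * Suc j)" if "j \<in> ?J" for j
  proof -
    have "2 * m choose (m - l * Suc j) = 2 * m choose (2 * m - (m - l * Suc j))"
      by (rule binomial_symmetric) simp
    also have "2 * m - (m - l * Suc j) = m + l * Suc j" using that by simp
    finally show ?thesis .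
  qed
  have "(\<Sum>r\<in>?L. real (2 * m choose r)) = real (2 * m choose m) +
     ((\<Sum>j\<in>?J. real (2 * m choose (m + l * Suc j))) + (\<Sum>j\<in>?J. real (2 * m choose (m - l * Suc j))))"
    unfolding eq using fin notin
    by (subst sum.insert)
       (simp_all only: finite_Un finite_imageI sum.union_disjoint[OF _ _ disj] sum.reindex[OF inj1]
          sum.reindex[OF inj2] o_def simp_thms)
  also have "(\<Sum>j\<in>?J. real (2 * m choose (m - l * Suc j))) = (\<Sum>j\<in>?J. real (2 * m choose (m + l * Suc j)))"
    by (intro sum.cong refl) (simp only: sym)
  finally show ?thesis by simp
qed

text \<open>The reflection k -> l - k negates the cosine, which the even exponent hides; for odd l
  it pairs off the nonzero indices, with representatives 1, ..., h.\<close>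

lemma sum_cos_power_symmetric:
  "(\<Sum>k<2*h+1. (2 * cos (pi * real k / real (2*h+1))) ^ (2 * m)) =
     4 ^ m * (1 + 2 * (\<Sum>k<h. cos (pi * real (Suc k) / real (2*h+1)) ^ (2 * m)))"
proof -
  define f where "f k = (2 * cos (pi * real k / real (2*h+1))) ^ (2 * m)" for k :: nat
  have eq: "{..<2*h+1} = insert 0 (Suc ` {..<h} \<union> (\<lambda>j. 2 * h - j) ` {..<h})" (is "_ = ?R")
  proof (intro equalityI subsetI)
    fix k assume k: "k \<in> {..<2*h+1}"
    consider "k = 0" | "k > 0" "k \<le> h" | "k > h" by linarith
    then show "k \<in> ?R"
    proof cases
      case 2
      then have "k = Suc (k - 1)" "k - 1 \<in> {..<h}" by auto
      then show ?thesis by blast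
    next
      case 3
      then have "k = 2 * h - (2 * h - k)" "2 * h - k \<in> {..<h}" using k by auto
      then show ?thesis by blast
    qed simp
  qed auto
  have disj: "Suc ` {..<h} \<inter> (\<lambda>j. 2 * h - j) ` {..<h} = {}" by auto
  have notin: "0 \<notin> Suc ` {..<h} \<union> (\<lambda>j. 2 * h - j) ` {..<h}" by auto
  have inj: "inj_on (\<lambda>j. 2 * h - j) {..<h}" by (auto simp: inj_on_def)
  have refl: "f (2 * h - j) = f (Suc j)" if "j < h" for j
  proof -
    have "pi * real (2 * h - j) / real (2*h+1) = pi - pi * real (Suc j) / real (2*h+1)"
      using that by (simp add: field_simps of_nat_diff)
    then have "cos (pi * real (2 * h - j) / real (2*h+1)) = - cos (pi * real (Suc j) / real (2*h+1))"
      by (simp only: cos_pi_minus)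
    then show ?thesis unfolding f_def power_mult by simp
  qed
  have "(\<Sum>k<2*h+1. f k) = f 0 + ((\<Sum>k<h. f (Suc k)) + (\<Sum>k<h. f (2 * h - k)))"
    unfolding eq using notin
    by (subst sum.insert)
       (simp_all only: finite_Un finite_imageI sum.union_disjoint[OF _ _ disj] sum.reindex[OF inj]
          sum.reindex[OF inj_Suc] sum.reindex[OF inj_on_subset[OF inj_Suc subset_UNIV]] o_def simp_thms finite_lessThan)
  also have "(\<Sum>k<h. f (2 * h - k)) = (\<Sum>k<h. f (Suc k))"
    by (intro sum.cong HOL.refl) (simp only: refl lessThan_iff)
  also have "f 0 = 4 ^ m" by (simp add: f_def power_mult)
  also have "(\<Sum>k<h. f (Suc k)) = 4 ^ m * (\<Sum>k<h. cos (pi * real (Suc k) / real (2*h+1)) ^ (2 * m))"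
    unfolding f_def power_mult_distrib sum_distrib_left by (simp add: power_mult)
  finally show ?thesis unfolding f_def by (simp add: algebra_simps)
qed

text \<open>A finite form of the inversion formula. Dividing by the central coefficient makes the
  terms on both sides tend to Gaussians and leaves a prefactor that Wallis's product
  evaluates.\<close>

lemma polya_identity:
  "1 + 2 * (\<Sum>k<h. cos (pi * real (Suc k) / real (2*h+1)) ^ (2 * m)) =
   real (2*h+1) * real (2 * m choose m) / 4 ^ m *
     (1 + 2 * (\<Sum>j | (2*h+1) * Suc j \<le> m. real (2 * m choose (m + (2*h+1) * Suc j)) / real (2 * m choose m)))"
proof -
  have "4 ^ m * (1 + 2 * (\<Sum>k<h. cos (pi * real (Suc k) / real (2*h+1)) ^ (2 * m))) =
    real (2*h+1) * (real (2 * m choose m) + 2 * (\<Sum>j | (2*h+1) * Suc j \<le> m. real (2 * m choose (m + (2*h+1) * Suc j))))"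
    using sum_cos_power_even[of "2*h+1" m] sum_cos_power_symmetric[of h m]
      sum_binomial_residue_class[of "2*h+1" m] by simp
  also have "\<dots> = real (2*h+1) * real (2 * m choose m) *
     (1 + 2 * (\<Sum>j | (2*h+1) * Suc j \<le> m. real (2 * m choose (m + (2*h+1) * Suc j)) / real (2 * m choose m)))"
    by (simp add: sum_divide_distrib [symmetric] field_simps del: mult_Suc_right)
  finally show ?thesis by (simp add: field_simps del: mult_Suc_right)
qed

section \<open>Limits and majorants for the finite identity\<close>

lemma tendsto_one_plus_power:
  fixes x :: "'a \<Rightarrow> real" and y :: "'a \<Rightarrow> nat"
  assumes x: "(x \<longlongrightarrow> 0) F" and xy: "((\<lambda>n. real (y n) * x n) \<longlongrightarrow> c) F"
  shows "((\<lambda>n. (1 + x n) ^ y n) \<longlongrightarrow> exp c) F"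
proof -
  \<comment> \<open>The value 1 fills the removable singularity, so indices with
    \<open>x n = 0\<close> need no separate treatment.\<close>
  define g :: "real \<Rightarrow> real" where "g u = (if u = 0 then 1 else ln (1 + u) / u)" for u
  have "((\<lambda>u::real. ln (1 + u) / u) \<longlongrightarrow> 1) (at 0)" by real_asymp
  then have "(g \<longlongrightarrow> 1) (at 0)"
    by (rule Lim_transform_eventually) (auto simp: g_def eventually_at_filter)
  then have "isCont g 0" by (simp add: isCont_def g_def)
  then have g: "((\<lambda>n. g (x n)) \<longlongrightarrow> 1) F"
    using isCont_tendsto_compose[OF _ x, of g] by (simp add: g_def)
  have "((\<lambda>n. exp (real (y n) * x n * g (x n))) \<longlongrightarrow> exp (c * 1)) F"
    by (intro tendsto_exp tendsto_mult xy g)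
  moreover have "eventually (\<lambda>n. x n > -1) F"
    using order_tendstoD(1)[OF x, of "-1"] by simp
  then have "eventually (\<lambda>n. exp (real (y n) * x n * g (x n)) = (1 + x n) ^ y n) F"
  proof eventually_elim
    case (elim n)
    have "x n * g (x n) = ln (1 + x n)" by (simp add: g_def)
    then have "exp (real (y n) * x n * g (x n)) = exp (real (y n) * ln (1 + x n))"
      by (simp add: mult.assoc)
    also have "\<dots> = (1 + x n) ^ y n" using elim by (simp add: exp_of_nat_mult)
    finally show ?case .
  qed
  ultimately show ?thesis using Lim_transform_eventually by fastforce
qed

text \<open>Majorant for the cosine side. Taylor's formula gives cos x \<le> 1 - x^2/2 + x^4/24, and
  x^2 \<le> 4 bounds the last term by x^2/6. The angles that occur stay below pi/2 < 2.\<close>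

lemma cos_le_exp_neg_square:
  fixes x :: real
  assumes "\<bar>x\<bar> \<le> 2"
  shows "cos x \<le> exp (- (x\<^sup>2 / 4))"
proof -
  obtain t where t: "cos x = (\<Sum>m<4. cos_coeff m * x ^ m) + cos (t + 1/2 * real 4 * pi) / fact 4 * x ^ 4"
    using Maclaurin_cos_expansion[of x 4] by blast
  have "{..<4::nat} = {0, 1, 2, 3}" by auto
  then have "(\<Sum>m<4. cos_coeff m * x ^ m) = 1 - x\<^sup>2 / 2"
    by (simp add: cos_coeff_def)
  moreover have "cos (t + 1/2 * real 4 * pi) / fact 4 * x ^ 4 \<le> 1 / 24 * x ^ 4"
    by (intro mult_right_mono) (auto simp: fact_numeral)
  moreover have "x ^ 4 \<le> 4 * x\<^sup>2"
  proof -
    have "x\<^sup>2 \<le> 2\<^sup>2" using assms by (metis abs_ge_zero power2_abs power_mono)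
    then have "x\<^sup>2 * x\<^sup>2 \<le> 4 * x\<^sup>2" by (intro mult_right_mono) auto
    then show ?thesis by (simp add: power_numeral_reduce power2_eq_square mult.assoc)
  qed
  ultimately have "cos x \<le> 1 - x\<^sup>2 / 4"
    using t zero_le_power2[of x] by linarith
  also have "\<dots> \<le> exp (- (x\<^sup>2 / 4))" using exp_ge_add_one_self[of "- (x\<^sup>2 / 4)"] by simp
  finally show ?thesis .
qed

lemma fact_add_eq_prod: "(fact (m + r) :: real) = fact m * (\<Prod>i<r. real (m + 1 + i))"
  by (induction r) (simp_all add: algebra_simps)

lemma binomial_central_ratio:
  assumes "r \<le> m"
  shows "real (2 * m choose (m + r)) / real (2 * m choose m) =
           (\<Prod>i<r. real (m - r + 1 + i) / real (m + 1 + i))"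
proof -
  have 1: "real (2 * m choose (m + r)) = fact (2 * m) / (fact (m + r) * fact (m - r))"
    using assms by (subst binomial_fact) auto
  have 2: "real (2 * m choose m) = fact (2 * m) / (fact m * fact m)"
    by (subst binomial_fact) auto
  have 3: "(fact m :: real) = fact (m - r) * (\<Prod>i<r. real (m - r + 1 + i))"
    using fact_add_eq_prod[of "m - r" r] assms by simp
  have "real (2 * m choose (m + r)) / real (2 * m choose m) = fact m / fact (m + r) * (fact m / fact (m - r))"
    unfolding 1 2 by (simp add: field_simps)
  also have "fact m / fact (m + r) = 1 / (\<Prod>i<r. real (m + 1 + i))"
    unfolding fact_add_eq_prod by simp
  also have "fact m / fact (m - r) = (\<Prod>i<r. real (m - r + 1 + i))"
    by (subst 3) simp
  finally show ?thesis by (simp add: prod_dividef)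
qed

text \<open>Each factor of the ratio equals 1 - r/(m + 1 + i), where m < m + 1 + i \<le> m + r. Both
  bounds will have the same Gaussian limit; the upper one also supplies the majorant.\<close>

lemma binomial_central_ratio_bounds:
  assumes "r \<le> m" "m > 0"
  shows "real (2 * m choose (m + r)) / real (2 * m choose m) \<le> (1 - real r / real (m + r)) ^ r"
    and "real (2 * m choose (m + r)) / real (2 * m choose m) \<ge> (1 - real r / real m) ^ r"
proof -
  have eq: "real (m - r + 1 + i) = real m - real r + real (Suc i)" for i using assms by simp
  have u: "real (m - r + 1 + i) / real (m + 1 + i) \<le> 1 - real r / real (m + r)" if "i < r" for i
  proof -
    have "real (Suc i) * real r \<le> real r * real r" using that by (intro mult_right_mono) auto
    then show ?thesis unfolding eq using assms by (simp add: field_simps)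
  qed
  have l: "real (m - r + 1 + i) / real (m + 1 + i) \<ge> 1 - real r / real m" if "i < r" for i
  proof -
    have "0 \<le> real r * real (Suc i)" by simp
    then show ?thesis unfolding eq using assms by (simp add: field_simps)
  qed
  show "real (2 * m choose (m + r)) / real (2 * m choose m) \<le> (1 - real r / real (m + r)) ^ r"
    unfolding binomial_central_ratio[OF assms(1)]
    using prod_mono[of "{..<r}" "\<lambda>i. real (m - r + 1 + i) / real (m + 1 + i)" "\<lambda>_. 1 - real r / real (m + r)"] u
    by auto
  show "real (2 * m choose (m + r)) / real (2 * m choose m) \<ge> (1 - real r / real m) ^ r"
    unfolding binomial_central_ratio[OF assms(1)]
    using prod_mono[of "{..<r}" "\<lambda>_. 1 - real r / real m" "\<lambda>i. real (m - r + 1 + i) / real (m + 1 + i)"] l assms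
    by (auto simp: field_simps)
qed

text \<open>Induction works because consecutive central binomial coefficients have quotient 2(2n +
  1)/(n + 1). Wallis's limit thereby becomes their asymptotics.\<close>

lemma wallis_prod_eq_binomial:
  "(\<Prod>k=1..n. (4 * real k ^ 2) / (4 * real k ^ 2 - 1)) =
     (4 ^ n / real (2 * n choose n))\<^sup>2 / real (2 * n + 1)"
proof (induction n)
  case (Suc n)
  have C: "real (2 * Suc n choose Suc n) * (real n + 1) = real (2 * n choose n) * 2 * (2 * real n + 1)"
  proof -
    have "Suc n * (2 * Suc n choose Suc n) = (2 * Suc n) * (2 * n + 1 choose n)"
      using Suc_times_binomial_eq[of "2 * n + 1" n] by (simp del: binomial_Suc_Suc)
    then have 1: "real (Suc n) * real (2 * Suc n choose Suc n) = 2 * real (Suc n) * real (2 * n + 1 choose n)"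
      by (metis of_nat_mult of_nat_numeral)
    have 2: "2 * n + 1 choose n = 2 * n + 1 choose Suc n"
      by (subst binomial_symmetric) auto
    have "Suc n * (2 * n + 1 choose Suc n) = (2 * n + 1) * (2 * n choose n)"
      using Suc_times_binomial_eq[of "2 * n" n] by (simp del: binomial_Suc_Suc)
    then have "real (Suc n) * real (2 * n + 1 choose Suc n) = real (2 * n + 1) * real (2 * n choose n)"
      by (metis of_nat_mult)
    with 1 2 show ?thesis by (simp add: algebra_simps del: binomial_Suc_Suc)
  qed
  have pos: "real (2 * n choose n) > 0" by simp
  have C': "real (2 * Suc n choose Suc n) = real (2 * n choose n) * 2 * (2 * real n + 1) / (real n + 1)"
    using C by (simp add: field_simps del: binomial_Suc_Suc)
  have "4 * real (Suc n) ^ 2 - 1 = (2 * real n + 1) * (2 * real n + 3)"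
    by (simp add: power2_eq_square algebra_simps)
  then have "(\<Prod>k=1..Suc n. (4 * real k ^ 2) / (4 * real k ^ 2 - 1)) =
    (4 ^ n / real (2 * n choose n))\<^sup>2 / (2 * real n + 1) * (4 * (real n + 1)\<^sup>2 / ((2 * real n + 1) * (2 * real n + 3)))"
    using Suc.IH by (simp add: add_ac)
  also have "\<dots> = (4 ^ Suc n / real (2 * Suc n choose Suc n))\<^sup>2 / real (2 * Suc n + 1)"
    unfolding C' using pos
    by (simp add: power_mult_distrib power_divide add_ac divide_simps del: binomial_eq_0_iff)
       (simp add: power2_eq_square algebra_simps)
  finally show ?case .
qed simp

lemma central_binomial_limit:
  "(\<lambda>n. real (2 * n choose n) / 4 ^ n * sqrt (real (2 * n + 1))) \<longlonglongrightarrow> sqrt (2 / pi)"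
proof -
  have "(\<lambda>n. sqrt (inverse ((4 ^ n / real (2 * n choose n))\<^sup>2 / real (2 * n + 1)))) \<longlonglongrightarrow> sqrt (inverse (pi / 2))"
    using wallis unfolding wallis_prod_eq_binomial
    by (intro tendsto_real_sqrt tendsto_inverse) auto
  also have "(\<lambda>n. sqrt (inverse ((4 ^ n / real (2 * n choose n))\<^sup>2 / real (2 * n + 1)))) =
     (\<lambda>n. real (2 * n choose n) / 4 ^ n * sqrt (real (2 * n + 1)))"
    by (intro ext) (simp add: real_sqrt_divide real_sqrt_mult del: of_nat_add)
  finally show ?thesis by simp
qed

lemma summable_exp_neg_Suc:
  assumes "(c::real) > 0"
  shows "summable (\<lambda>k. exp (- (c * real (Suc k))))"
proof -
  have "summable (\<lambda>k. exp (-c) ^ Suc k)"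
    using assms by (subst summable_Suc_iff) (auto intro!: summable_geometric)
  then show ?thesis by (subst (asm) exp_of_nat_mult [symmetric]) (simp add: mult_ac)
qed

lemma suminf_if_finite:
  fixes f :: "nat \<Rightarrow> real"
  assumes "finite {j. P j}"
  shows "(\<Sum>j. if P j then f j else 0) = (\<Sum>j | P j. f j)"
  using sums_If_finite[OF assms, of f] by (simp add: sums_iff)

text \<open>Polya's proof of the inversion formula: evaluate the sum of \<open>(2 cos (\<pi>k/l))\<^sup>2\<^sup>m\<close> over \<open>k\<close> modulo
  \<open>l\<close> by roots of unity as a sum of binomial coefficients, and let \<open>l \<rightarrow> \<infinity>\<close> with \<open>m \<sim> l\<^sup>2s\<close>.\<close>

lemma theta_sum_inversion:
  fixes s :: real
  assumes s: "s > 0"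
  shows "1 + 2 * (\<Sum>k. exp (- (pi\<^sup>2 * s * (real (Suc k))\<^sup>2))) =
           1 / sqrt (pi * s) * (1 + 2 * (\<Sum>j. exp (- ((real (Suc j))\<^sup>2 / s))))"
proof -
  \<comment> \<open>Odd moduli, as in \<open>polya_identity\<close>; \<open>m\<close> is l^2 s
    rounded down, so m / l^2 tends to s from below.\<close>
  define l where "l h = 2 * h + 1" for h :: nat
  define m where "m h = nat \<lfloor>(real (l h))\<^sup>2 * s\<rfloor>" for h
  have l_pos: "real (l h) > 0" for h by (simp add: l_def)
  have m_le: "real (m h) \<le> (real (l h))\<^sup>2 * s" for h
    using s by (simp add: m_def)
  have m_ge: "real (m h) \<ge> (real (l h))\<^sup>2 * s - 1" for h
    using s by (simp add: m_def)
  have inv_l: "(\<lambda>h. 1 / real (l h)) \<longlonglongrightarrow> 0"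
    unfolding l_def by real_asymp
  have ratio: "(\<lambda>h. real (m h) / (real (l h))\<^sup>2) \<longlonglongrightarrow> s"
  proof (rule real_tendsto_sandwich)
    show "\<forall>\<^sub>F h in sequentially. s - 1 / (real (l h))\<^sup>2 \<le> real (m h) / (real (l h))\<^sup>2"
    proof (intro always_eventually allI)
      fix h
      have "s - 1 / (real (l h))\<^sup>2 = ((real (l h))\<^sup>2 * s - 1) / (real (l h))\<^sup>2"
        by (simp add: diff_divide_distrib l_def)
      also have "\<dots> \<le> real (m h) / (real (l h))\<^sup>2"
        by (intro divide_right_mono m_ge) simp
      finally show "s - 1 / (real (l h))\<^sup>2 \<le> real (m h) / (real (l h))\<^sup>2" .
    qed
    show "\<forall>\<^sub>F h in sequentially. real (m h) / (real (l h))\<^sup>2 \<le> s"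
      using m_le s by (intro always_eventually allI) (simp add: divide_le_eq mult.commute)
    show "(\<lambda>h. s - 1 / (real (l h))\<^sup>2) \<longlonglongrightarrow> s" unfolding l_def by real_asymp
  qed simp
  have m_lim: "filterlim (\<lambda>h. real (m h)) at_top sequentially"
  proof (rule filterlim_at_top_mono)
    show "filterlim (\<lambda>h. (real (l h))\<^sup>2 * s - 1) at_top sequentially"
      unfolding l_def using s by real_asymp
  qed (use m_ge in auto)
  have m_lim': "filterlim m at_top sequentially"
    using m_lim by (simp add: filterlim_sequentially_iff_filterlim_real)
  have m_pos: "\<forall>\<^sub>F h in sequentially. m h > 0"
    using eventually_compose_filterlim[OF eventually_gt_at_top[of 0] m_lim'] .
  have l_over_m: "(\<lambda>h. real (l h) / real (m h)) \<longlonglongrightarrow> 0"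
  proof -
    have "(\<lambda>h. (1 / real (l h)) / (real (m h) / (real (l h))\<^sup>2)) \<longlonglongrightarrow> 0 / s"
      using s by (intro tendsto_divide inv_l ratio) auto
    moreover have "(1 / real (l h)) / (real (m h) / (real (l h))\<^sup>2) = real (l h) / real (m h)" for h
      using l_pos[of h] by (cases "m h = 0") (simp_all add: power2_eq_square field_simps)
    ultimately show ?thesis by simp
  qed

  \<comment> \<open>Extension by zero turns both finite sums into series over a fixed index set, as
    Tannery's theorem requires.\<close>
  define a where "a k h = (if k < h then cos (pi * real (Suc k) / real (l h)) ^ (2 * m h) else 0)" for k h
  define b where "b j h = (if l h * Suc j \<le> m h then
      real (2 * m h choose (m h + l h * Suc j)) / real (2 * m h choose m h) else 0)" for j h

  have a_lim: "(\<lambda>h. a k h) \<longlonglongrightarrow> exp (- (pi\<^sup>2 * s * (real (Suc k))\<^sup>2))" for k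
  proof -
    define x where "x h = pi * real (Suc k) / real (l h)" for h
    have x0: "x h \<noteq> 0" for h by (simp add: x_def l_def add_eq_0_iff)
    have x_lim: "x \<longlonglongrightarrow> 0"
      using tendsto_mult_right[OF inv_l, of "pi * real (Suc k)"] by (simp add: x_def [abs_def])
    have x_at: "filterlim x (at 0) sequentially"
      using x_lim x0 by (simp add: filterlim_at)
    have "((\<lambda>x::real. (cos x - 1) / x\<^sup>2) \<longlongrightarrow> -1/2) (at 0)" by real_asymp
    from filterlim_compose[OF this x_at]
    have c: "(\<lambda>h. (cos (x h) - 1) / (x h)\<^sup>2) \<longlonglongrightarrow> -1/2" by (simp add: o_def)
    have mx: "(\<lambda>h. real (m h) * (x h)\<^sup>2) \<longlonglongrightarrow> pi\<^sup>2 * s * (real (Suc k))\<^sup>2"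
    proof -
      have "(\<lambda>h. (pi * real (Suc k))\<^sup>2 * (real (m h) / (real (l h))\<^sup>2)) \<longlonglongrightarrow> (pi * real (Suc k))\<^sup>2 * s"
        by (intro tendsto_mult tendsto_const ratio)
      then show ?thesis by (simp add: x_def power_divide power_mult_distrib mult_ac)
    qed
    have "(\<lambda>h. 2 * (real (m h) * (x h)\<^sup>2) * ((cos (x h) - 1) / (x h)\<^sup>2)) \<longlonglongrightarrow>
        2 * (pi\<^sup>2 * s * (real (Suc k))\<^sup>2) * (-1/2)"
      by (intro tendsto_mult tendsto_const mx c)
    moreover have "2 * (real (m h) * (x h)\<^sup>2) * ((cos (x h) - 1) / (x h)\<^sup>2) = real (2 * m h) * (cos (x h) - 1)" for h
      using x0[of h] by simp
    ultimately have 1: "(\<lambda>h. real (2 * m h) * (cos (x h) - 1)) \<longlonglongrightarrow> - (pi\<^sup>2 * s * (real (Suc k))\<^sup>2)"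
      by simp
    have "(\<lambda>h. cos (x h) - 1) \<longlonglongrightarrow> cos 0 - 1"
      by (intro tendsto_intros x_lim)
    then have "(\<lambda>h. (1 + (cos (x h) - 1)) ^ (2 * m h)) \<longlonglongrightarrow> exp (- (pi\<^sup>2 * s * (real (Suc k))\<^sup>2))"
      using 1 by (intro tendsto_one_plus_power) auto
    moreover have "\<forall>\<^sub>F h in sequentially. (1 + (cos (x h) - 1)) ^ (2 * m h) = a k h"
      using eventually_gt_at_top[of k] by eventually_elim (simp add: a_def x_def)
    ultimately show ?thesis by (rule Lim_transform_eventually)
  qed
  \<comment> \<open>Eventually m / l^2 > s/2, and the cosine bound gives exp(-m x^2 / 2). Dropping
    pi^2 \<ge> 1 and weakening (k + 1)^2 to k + 1 leaves a geometric majorant with rate s/4.\<close>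
  have a_bound: "\<forall>\<^sub>F (k,h) in at_top \<times>\<^sub>F sequentially. norm (a k h) \<le> exp (- (s / 4 * real (Suc k)))"
  proof -
    have "\<forall>\<^sub>F h in sequentially. real (m h) / (real (l h))\<^sup>2 > s / 2"
      using s by (intro order_tendstoD(1)[OF ratio]) simp
    then have "\<forall>\<^sub>F h in sequentially. \<forall>k. norm (a k h) \<le> exp (- (s / 4 * real (Suc k)))"
    proof eventually_elim
      case (elim h)
      show ?case
      proof
        fix k
        show "norm (a k h) \<le> exp (- (s / 4 * real (Suc k)))"
        proof (cases "k < h")
          case True
          define x where "x = pi * real (Suc k) / real (l h)"
          have x0: "x > 0" by (simp add: x_def l_def add_pos_nonneg)
          have "real (Suc k) / real (l h) \<le> 1 / 2" using True by (simp add: l_def field_simps)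
          from mult_left_mono[OF this, of pi] have xle: "x \<le> pi / 2" by (simp add: x_def)
          have "pi / 2 < 2" using pi_half_less_two .
          then have "cos x \<le> exp (- (x\<^sup>2 / 4))" using x0 xle by (intro cos_le_exp_neg_square) auto
          moreover have c0: "cos x \<ge> 0" using x0 xle by (intro cos_ge_zero) auto
          ultimately have "cos x ^ (2 * m h) \<le> exp (- (x\<^sup>2 / 4)) ^ (2 * m h)" by (intro power_mono)
          also have "\<dots> = exp (- (real (m h) * x\<^sup>2 / 2))"
            by (subst exp_of_nat_mult [symmetric]) (simp add: field_simps)
          also have "\<dots> \<le> exp (- (s / 4 * real (Suc k)))"
          proof -
            have "real (m h) * x\<^sup>2 = real (m h) / (real (l h))\<^sup>2 * (pi\<^sup>2 * (real (Suc k))\<^sup>2)"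
              by (simp add: x_def power_divide power_mult_distrib)
            also have "\<dots> \<ge> s / 2 * (1 * real (Suc k))"
            proof (intro mult_mono)
              have "1\<^sup>2 \<le> pi\<^sup>2" using pi_gt3 by (intro power_mono) auto
              then show "1 \<le> pi\<^sup>2" by simp
              show "real (Suc k) \<le> (real (Suc k))\<^sup>2" by (simp add: power2_eq_square)
            qed (use elim s in auto)
            finally show ?thesis by simp
          qed
          finally show ?thesis using True c0 by (simp add: a_def x_def)
        qed (simp add: a_def)
      qed
    qed
    from eventually_prodI[OF always_eventually[of "\<lambda>_. True"] this]
    show ?thesis by (rule eventually_mono) auto
  qed
  have a_sum: "(\<lambda>h. \<Sum>k. a k h) \<longlonglongrightarrow> (\<Sum>k. exp (- (pi\<^sup>2 * s * (real (Suc k))\<^sup>2)))"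
    using tannerys_theorem[OF a_lim a_bound summable_exp_neg_Suc] s by simp

  have b_lim: "(\<lambda>h. b j h) \<longlonglongrightarrow> exp (- ((real (Suc j))\<^sup>2 / s))" for j
  proof -
    define r where "r h = l h * Suc j" for h
    have rm: "(\<lambda>h. real (r h) / real (m h)) \<longlonglongrightarrow> 0"
      using tendsto_mult_left[OF l_over_m, of "real (Suc j)"] by (simp add: r_def algebra_simps)
    have r_le: "\<forall>\<^sub>F h in sequentially. r h \<le> m h"
    proof -
      have "\<forall>\<^sub>F h in sequentially. real (r h) / real (m h) < 1"
        using order_tendstoD(2)[OF rm, of 1] by simp
      then show ?thesis using m_pos by eventually_elim (simp add: field_simps)
    qed
    have rrm: "(\<lambda>h. real (r h) * (real (r h) / real (m h))) \<longlonglongrightarrow> (real (Suc j))\<^sup>2 / s"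
    proof -
      have "(\<lambda>h. (real (Suc j))\<^sup>2 / (real (m h) / (real (l h))\<^sup>2)) \<longlonglongrightarrow> (real (Suc j))\<^sup>2 / s"
        using s by (intro tendsto_divide tendsto_const ratio) auto
      then show ?thesis by (simp only: r_def of_nat_mult) (simp add: power2_eq_square mult_ac del: of_nat_Suc)
    qed
    have rm': "(\<lambda>h. real (r h) / real (m h + r h)) \<longlonglongrightarrow> 0"
    proof (rule real_tendsto_sandwich[OF _ _ tendsto_const rm])
      show "\<forall>\<^sub>F h in sequentially. real (r h) / real (m h + r h) \<le> real (r h) / real (m h)"
        using m_pos by eventually_elim (simp add: frac_le)
    qed simp
    \<comment> \<open>Since r^2/(m + r) = (r^2/m)(1 - r/(m + r)) and r/m tends to 0, the two
      binomial bounds squeeze \<open>b j h\<close> to a single limit.\<close>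
    have rrm': "(\<lambda>h. real (r h) * (real (r h) / real (m h + r h))) \<longlonglongrightarrow> (real (Suc j))\<^sup>2 / s"
    proof -
      have "(\<lambda>h. real (r h) * (real (r h) / real (m h)) * (1 - real (r h) / real (m h + r h))) \<longlonglongrightarrow> (real (Suc j))\<^sup>2 / s * (1 - 0)"
        by (intro tendsto_mult rrm tendsto_diff tendsto_const rm')
      moreover have "\<forall>\<^sub>F h in sequentially. real (r h) * (real (r h) / real (m h)) * (1 - real (r h) / real (m h + r h)) =
             real (r h) * (real (r h) / real (m h + r h))"
        using m_pos
      proof eventually_elim
        case (elim h)
        then have "1 - real (r h) / real (m h + r h) = real (m h) / real (m h + r h)"
          by (simp add: field_simps)
        then show ?case using elim by simp
      qed
      ultimately show ?thesis using Lim_transform_eventually by fastforce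
    qed
    show ?thesis
    proof (rule real_tendsto_sandwich)
      show "(\<lambda>h. (1 + (- (real (r h) / real (m h)))) ^ r h) \<longlonglongrightarrow> exp (- ((real (Suc j))\<^sup>2 / s))"
        using tendsto_minus[OF rm] tendsto_minus[OF rrm] by (intro tendsto_one_plus_power) auto
      show "(\<lambda>h. (1 + (- (real (r h) / real (m h + r h)))) ^ r h) \<longlonglongrightarrow> exp (- ((real (Suc j))\<^sup>2 / s))"
        using tendsto_minus[OF rm'] tendsto_minus[OF rrm'] by (intro tendsto_one_plus_power) auto
      show "\<forall>\<^sub>F h in sequentially. (1 + (- (real (r h) / real (m h)))) ^ r h \<le> b j h"
        using r_le m_pos
      proof eventually_elim
        case (elim h)
        then show ?case using binomial_central_ratio_bounds(2)[OF elim] by (simp add: b_def del: mult_Suc_right flip: r_def)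
      qed
      show "\<forall>\<^sub>F h in sequentially. b j h \<le> (1 + (- (real (r h) / real (m h + r h)))) ^ r h"
        using r_le m_pos
      proof eventually_elim
        case (elim h)
        then show ?case using binomial_central_ratio_bounds(1)[OF elim] by (simp add: b_def del: mult_Suc_right flip: r_def)
      qed
    qed
  qed
  \<comment> \<open>For r \<le> m one has m + r \<le> 2m, and m \<le> l^2 s makes r^2/(2m) at least
    (j + 1)^2/(2s).\<close>
  have b_bound: "\<forall>\<^sub>F (j,h) in at_top \<times>\<^sub>F sequentially. norm (b j h) \<le> exp (- (1 / (2 * s) * real (Suc j)))"
  proof -
    have "\<forall>\<^sub>F h in sequentially. \<forall>j. norm (b j h) \<le> exp (- (1 / (2 * s) * real (Suc j)))"
      using m_pos
    proof eventually_elim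
      case (elim h)
      show ?case
      proof
        fix j
        define r where "r = l h * Suc j"
        show "norm (b j h) \<le> exp (- (1 / (2 * s) * real (Suc j)))"
        proof (cases "r \<le> m h")
          case True
          have "norm (b j h) = real (2 * m h choose (m h + r)) / real (2 * m h choose m h)"
            using True by (simp add: b_def r_def del: mult_Suc_right)
          also have "\<dots> \<le> (1 - real r / real (m h + r)) ^ r"
            by (rule binomial_central_ratio_bounds(1)[OF True elim])
          also have "\<dots> \<le> exp (- (real r / real (2 * m h))) ^ r"
          proof (rule power_mono)
            have "1 - real r / real (m h + r) \<le> 1 - real r / real (2 * m h)"
              using True elim by (simp add: frac_le)
            also have "\<dots> \<le> exp (- (real r / real (2 * m h)))"
              using exp_ge_add_one_self[of "- (real r / real (2 * m h))"] by simp
            finally show "1 - real r / real (m h + r) \<le> exp (- (real r / real (2 * m h)))" .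
          qed (use elim in auto)
          also have "\<dots> = exp (- (real r * (real r / real (2 * m h))))"
            by (subst exp_of_nat_mult [symmetric]) simp
          also have "\<dots> \<le> exp (- (1 / (2 * s) * real (Suc j)))"
          proof -
            have "1 / (2 * s) * real (Suc j) \<le> (real (Suc j))\<^sup>2 / (2 * s)"
              using s by (simp add: field_simps power2_eq_square)
            also have "\<dots> = (real (Suc j))\<^sup>2 * (real (l h))\<^sup>2 / (2 * ((real (l h))\<^sup>2 * s))"
              by (simp add: l_def)
            also have "\<dots> \<le> (real (Suc j))\<^sup>2 * (real (l h))\<^sup>2 / (2 * real (m h))"
              using m_le[of h] elim s l_pos[of h] by (intro divide_left_mono) (auto intro!: mult_pos_pos)
            also have "\<dots> = real r * (real r / real (2 * m h))"
              by (simp only: r_def of_nat_mult) (simp add: power2_eq_square mult_ac del: of_nat_Suc)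
            finally show ?thesis by simp
          qed
          finally show ?thesis .
        qed (simp add: b_def r_def del: mult_Suc_right)
      qed
    qed
    from eventually_prodI[OF always_eventually[of "\<lambda>_. True"] this]
    show ?thesis by (rule eventually_mono) auto
  qed
  have b_sum: "(\<lambda>h. \<Sum>j. b j h) \<longlonglongrightarrow> (\<Sum>j. exp (- ((real (Suc j))\<^sup>2 / s)))"
    using tannerys_theorem[OF b_lim b_bound summable_exp_neg_Suc] s by simp

  \<comment> \<open>The central coefficient over 4^m behaves like sqrt(2/pi) / sqrt(2m + 1), while
    sqrt(2m + 1) / l tends to sqrt(2s).\<close>
  have pre: "(\<lambda>h. real (l h) * real (2 * m h choose m h) / 4 ^ m h) \<longlonglongrightarrow> 1 / sqrt (pi * s)"
  proof -
    have "(\<lambda>h. real (2 * m h choose m h) / 4 ^ m h * sqrt (real (2 * m h + 1))) \<longlonglongrightarrow> sqrt (2 / pi)"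
      using filterlim_compose[OF central_binomial_limit m_lim'] by simp
    moreover have "(\<lambda>h. 1 / sqrt (2 * (real (m h) / (real (l h))\<^sup>2) + (1 / real (l h))\<^sup>2)) \<longlonglongrightarrow>
        1 / sqrt (2 * s + 0\<^sup>2)"
      using s by (intro tendsto_intros ratio inv_l) auto
    ultimately have "(\<lambda>h. real (2 * m h choose m h) / 4 ^ m h * sqrt (real (2 * m h + 1)) *
         (1 / sqrt (2 * (real (m h) / (real (l h))\<^sup>2) + (1 / real (l h))\<^sup>2))) \<longlonglongrightarrow> sqrt (2 / pi) * (1 / sqrt (2 * s + 0\<^sup>2))"
      by (rule tendsto_mult)
    also have "sqrt (2 / pi) * (1 / sqrt (2 * s + 0\<^sup>2)) = 1 / sqrt (pi * s)"
      by (simp add: real_sqrt_divide real_sqrt_mult)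
    also have "(\<lambda>h. real (2 * m h choose m h) / 4 ^ m h * sqrt (real (2 * m h + 1)) *
         (1 / sqrt (2 * (real (m h) / (real (l h))\<^sup>2) + (1 / real (l h))\<^sup>2))) =
         (\<lambda>h. real (l h) * real (2 * m h choose m h) / 4 ^ m h)"
    proof
      fix h
      have l0: "real (l h) > 0" by (simp add: l_def)
      have "2 * (real (m h) / (real (l h))\<^sup>2) + (1 / real (l h))\<^sup>2 = real (2 * m h + 1) / (real (l h))\<^sup>2"
        using l0 by (simp add: field_simps)
      then have "sqrt (2 * (real (m h) / (real (l h))\<^sup>2) + (1 / real (l h))\<^sup>2) = sqrt (real (2 * m h + 1)) / real (l h)"
        using l0 by (simp add: real_sqrt_divide)
      moreover have "sqrt (real (2 * m h + 1)) > 0" by simp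
      ultimately show "real (2 * m h choose m h) / 4 ^ m h * sqrt (real (2 * m h + 1)) *
         (1 / sqrt (2 * (real (m h) / (real (l h))\<^sup>2) + (1 / real (l h))\<^sup>2)) = real (l h) * real (2 * m h choose m h) / 4 ^ m h"
        by (simp del: of_nat_add)
    qed
    finally show ?thesis .
  qed
  have id: "1 + 2 * (\<Sum>k. a k h) = real (l h) * real (2 * m h choose m h) / 4 ^ m h * (1 + 2 * (\<Sum>j. b j h))" for h
  proof -
    have fin: "finite {j. l h * Suc j \<le> m h}"
      by (rule finite_subset[of _ "{..m h}"]) (auto simp: l_def)
    have "(\<Sum>k. a k h) = (\<Sum>k<h. cos (pi * real (Suc k) / real (l h)) ^ (2 * m h))"
      unfolding a_def by (subst suminf_if_finite) (auto simp: lessThan_def)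
    moreover have "(\<Sum>j. b j h) = (\<Sum>j | l h * Suc j \<le> m h. real (2 * m h choose (m h + l h * Suc j)) / real (2 * m h choose m h))"
      unfolding b_def by (rule suminf_if_finite[OF fin])
    ultimately show ?thesis using polya_identity[of h "m h"] by (simp only: l_def)
  qed
  have "(\<lambda>h. 1 + 2 * (\<Sum>k. a k h)) \<longlonglongrightarrow> 1 + 2 * (\<Sum>k. exp (- (pi\<^sup>2 * s * (real (Suc k))\<^sup>2)))"
    by (intro tendsto_intros a_sum)
  moreover have "(\<lambda>h. 1 + 2 * (\<Sum>k. a k h)) \<longlonglongrightarrow>
      1 / sqrt (pi * s) * (1 + 2 * (\<Sum>j. exp (- ((real (Suc j))\<^sup>2 / s))))"
    unfolding id by (intro tendsto_intros pre b_sum)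
  ultimately show ?thesis by (rule LIMSEQ_unique)
qed

section \<open>A vanishing criterion for modular forms\<close>

text \<open>\<open>B\<close> only expresses boundedness; \<open>A\<close> is the bound that
  propagates from the edge. Division by a linear \<open>D\<close> with modulus at least 1 tames f on
  a far arc, so the maximum principle applies on a half disc, and the slope \<open>e\<close> of
  \<open>D\<close> can be taken arbitrarily small.\<close>

lemma phragmen_lindelof_halfplane:
  assumes hol: "f holomorphic_on {z. Im z > b}" and "b < c"
    and B: "\<And>z. Im z \<ge> c \<Longrightarrow> norm (f z) \<le> B"
    and A: "\<And>z. Im z = c \<Longrightarrow> norm (f z) \<le> A"
    and z: "Im z \<ge> c"
  shows "norm (f z) \<le> A"
proof (rule field_le_epsilon)
  fix d :: real assume d: "d > 0"
  define w where "w = \<i> * of_real c"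
  have A0: "A \<ge> 0" using A[of w] norm_ge_zero[of "f w"] by (simp add: w_def del: norm_ge_zero)
  have B0: "B \<ge> 0" using B[of w] norm_ge_zero[of "f w"] by (simp add: w_def del: norm_ge_zero)
  \<comment> \<open>\<open>A\<close> may be 0, and both \<open>e\<close> and \<open>R\<close> below
    divide by this bound.\<close>
  define A' where "A' = A + d / 2"
  have A': "A' > 0" "A \<le> A'" using A0 d by (auto simp: A'_def)
  \<comment> \<open>Chosen so that multiplying back by \<open>D z\<close> costs at most d/2; the
    summand 1 covers z = w.\<close>
  define e where "e = (d / 2) / (A' * (norm (z - w) + 1))"
  have np: "norm (z - w) + 1 > 0" by (simp add: add_nonneg_pos)
  have e: "e > 0" using d A' np by (simp add: e_def)
  define D where "D u = \<i> + of_real e * (u - w)" for u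
  have ImD: "Im (D u) \<ge> 1" if "Im u \<ge> c" for u
    using that e by (simp add: D_def w_def)
  have D1: "norm (D u) \<ge> 1" if "Im u \<ge> c" for u
    using ImD[OF that] abs_Im_le_cmod[of "D u"] by linarith
  have D0: "D u \<noteq> 0" if "Im u \<ge> c" for u using D1[OF that] by auto
  \<comment> \<open>Large enough for z to lie in the disc and for |D| \<ge> e R - 1 \<ge> B / A' on
    the arc.\<close>
  define R where "R = norm (z - w) + (B / A' + 1) / e"
  define S where "S = {u. Im u \<ge> c} \<inter> cball w R"
  have closed: "closed S" unfolding S_def by (intro closed_Int closed_halfspace_Im_ge closed_cball)
  have sub: "S \<subseteq> {z. Im z > b}" using \<open>b < c\<close> by (auto simp: S_def)
  have hol_g: "(\<lambda>u. f u / D u) holomorphic_on S"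
  proof (intro holomorphic_on_divide)
    show "f holomorphic_on S" by (rule holomorphic_on_subset[OF hol sub])
    show "D holomorphic_on S" unfolding D_def by (intro holomorphic_intros)
  qed (use D0 in \<open>auto simp: S_def\<close>)
  have fr: "Im u = c \<and> u \<in> S \<or> norm (u - w) = R \<and> u \<in> S" if "u \<in> frontier S" for u
  proof -
    have "u \<in> S" using that closed by (auto simp: frontier_def)
    have "{u. Im u > c} \<inter> ball w R \<subseteq> interior S"
      by (intro interior_maximal open_Int open_halfspace_Im_gt open_ball) (auto simp: S_def)
    then have "u \<notin> {u. Im u > c} \<inter> ball w R" using that by (auto simp: frontier_def)
    then show ?thesis using \<open>u \<in> S\<close> by (auto simp: S_def dist_norm norm_minus_commute)
  qed
  have "norm (f z / D z) \<le> A'"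
  proof (rule maximum_modulus_frontier[of "\<lambda>u. f u / D u" S A' z])
    show "(\<lambda>u. f u / D u) holomorphic_on interior S"
      by (rule holomorphic_on_subset[OF hol_g interior_subset])
    show "continuous_on (closure S) (\<lambda>u. f u / D u)"
      using closed holomorphic_on_imp_continuous_on[OF hol_g] by simp
    show "bounded S" unfolding S_def by (intro bounded_Int disjI2 bounded_cball)
    show "z \<in> S" using z A' B0 e by (simp add: S_def R_def dist_norm norm_minus_commute)
    fix u assume "u \<in> frontier S"
    from fr[OF this] show "norm (f u / D u) \<le> A'"
    proof
      assume u: "Im u = c \<and> u \<in> S"
      have "norm (f u / D u) \<le> norm (f u) / 1"
        unfolding norm_divide using D1[of u] u by (intro divide_left_mono) auto
      also have "\<dots> \<le> A'" using A[of u] u A' by simp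
      finally show ?thesis .
    next
      assume u: "norm (u - w) = R \<and> u \<in> S"
      then have Im: "Im u \<ge> c" by (simp add: S_def)
      have "e * R = e * norm (z - w) + (B / A' + 1)"
        unfolding R_def distrib_left[of e "norm (z - w)"] using e by simp
      then have "B / A' + 1 \<le> e * R" using e by simp
      also have "e * R = norm (D u - \<i>)" using u e by (simp add: D_def norm_mult)
      also have "\<dots> \<le> norm (D u) + 1" using norm_triangle_ineq4[of "D u" \<i>] by simp
      finally have "B \<le> A' * norm (D u)" using A' by (simp add: field_simps)
      then have "norm (f u) \<le> A' * norm (D u)" using B[OF Im] by simp
      then show ?thesis using D1[OF Im] A' by (simp add: norm_divide divide_le_eq)
    qed
  qed
  then have "norm (f z) \<le> A' * norm (D z)" using D0[OF z] by (simp add: norm_divide divide_le_eq)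
  also have "A' * norm (D z) \<le> A' * (1 + e * norm (z - w))"
    using A' norm_triangle_ineq[of \<i> "of_real e * (z - w)"] e by (intro mult_left_mono) (auto simp: D_def norm_mult)
  also have "A' * (1 + e * norm (z - w)) \<le> A' * (1 + e * (norm (z - w) + 1))"
    using A' e by (intro mult_left_mono add_left_mono) auto
  also have "e * (norm (z - w) + 1) = (d / 2) / A'" using np by (simp add: e_def)
  also have "A' * (1 + (d / 2) / A') = A' + d / 2" using A' by (simp add: field_simps)
  finally show "norm (f z) \<le> A + d" using A' by (simp add: A'_def)
qed

abbreviation upper_half_plane :: "complex set" where
  "upper_half_plane \<equiv> {\<tau>. Im \<tau> > 0}"

lemma connected_upper_half_plane: "connected upper_half_plane"
  by (intro convex_connected convex_halfspace_Im_gt)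

lemma Im_neg_inverse: "Im (-1 / \<tau>) = Im \<tau> / (norm \<tau>)\<^sup>2"
  by (simp add: Im_divide cmod_power2)

lemma holomorphic_mult_eq_0:
  assumes f: "f holomorphic_on S" and g: "g holomorphic_on S" and S: "open S" "connected S"
    and fg: "\<And>z. z \<in> S \<Longrightarrow> f z * g z = 0"
  shows "(\<forall>z\<in>S. f z = 0) \<or> (\<forall>z\<in>S. g z = 0)"
proof (rule disjCI)
  assume "\<not> (\<forall>z\<in>S. g z = 0)"
  then obtain z0 where z0: "z0 \<in> S" "g z0 \<noteq> 0" by blast
  define U where "U = {z \<in> S. g z \<in> - {0}}"
  have "open U"
    unfolding U_def
    using continuous_open_preimage[OF holomorphic_on_imp_continuous_on[OF g] S(1), of "- {0}"]
    by (simp add: vimage_def Int_def open_Compl)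
  moreover have "f z = 0" if "z \<in> U" for z using fg[of z] that by (auto simp: U_def)
  ultimately show "\<forall>z\<in>S. f z = 0"
    using analytic_continuation_open[of U S f "\<lambda>_. 0"] z0 S f by (auto simp: U_def)
qed

lemma holomorphic_prod_eq_0:
  assumes "finite W" "\<And>f. f \<in> W \<Longrightarrow> f holomorphic_on S" "open S" "connected S" "S \<noteq> {}"
    and "\<And>z. z \<in> S \<Longrightarrow> (\<Prod>f\<in>W. f z) = 0"
  shows "\<exists>f\<in>W. \<forall>z\<in>S. f z = 0"
  using assms
proof (induction W rule: finite_induct)
  case empty
  then show ?case by auto
next
  case (insert f W)
  have "(\<lambda>z. \<Prod>f\<in>W. f z) holomorphic_on S"
    using insert.prems by (intro holomorphic_on_prod) auto
  then have "(\<forall>z\<in>S. f z = 0) \<or> (\<forall>z\<in>S. (\<Prod>f\<in>W. f z) = 0)"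
    using insert by (intro holomorphic_mult_eq_0) auto
  then show ?case using insert by auto
qed

text \<open>A crude fundamental domain suffices: if \<open>\<bar>Re \<tau>\<bar> \<le> 1/2\<close> and \<open>Im \<tau> < 1/2\<close>, then
  \<open>\<tau> \<mapsto> -1/\<tau>\<close> at least doubles the imaginary part.\<close>

lemma modular_invariant_reduce:
  fixes h :: "complex \<Rightarrow> 'a"
  assumes T: "\<And>\<tau>. Im \<tau> > 0 \<Longrightarrow> h (\<tau> + 1) = h \<tau>"
    and S: "\<And>\<tau>. Im \<tau> > 0 \<Longrightarrow> h (-1 / \<tau>) = h \<tau>"
    and \<tau>: "Im \<tau> > 0"
  shows "\<exists>\<tau>'. Im \<tau>' \<ge> 1/2 \<and> h \<tau>' = h \<tau>"
proof -
  have T_nat: "h (\<tau> + of_nat n) = h \<tau>" if "Im \<tau> > 0" for \<tau> n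
  proof (induction n)
    case (Suc n)
    have "h (\<tau> + of_nat (Suc n)) = h ((\<tau> + of_nat n) + 1)" by (simp add: add_ac)
    also have "\<dots> = h \<tau>" using T[of "\<tau> + of_nat n"] that Suc by simp
    finally show ?case .
  qed simp
  have T_int: "h (\<tau> + of_int n) = h \<tau>" if "Im \<tau> > 0" for \<tau> n
  proof (cases "n \<ge> 0")
    case True
    then show ?thesis using T_nat[OF that, of "nat n"] by (simp add: of_nat_nat)
  next
    case False
    have "h (\<tau> + of_int n) = h (\<tau> + of_int n + of_nat (nat (- n)))"
      using that by (intro T_nat [symmetric]) simp
    then show ?thesis using False by (simp add: of_nat_nat)
  qed
  \<comment> \<open>Here \<open>n\<close> bounds the number of doublings of the imaginary part that
    are still needed.\<close>
  have "\<exists>\<tau>'. Im \<tau>' \<ge> 1/2 \<and> h \<tau>' = h \<tau>" if "Im \<tau> > 0" "Im \<tau> * 2 ^ n \<ge> 1/2" for n \<tau>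
    using that
  proof (induction n arbitrary: \<tau>)
    case 0
    then show ?case by auto
  next
    case (Suc n)
    show ?case
    proof (cases "Im \<tau> \<ge> 1/2")
      case False
      define \<sigma> where "\<sigma> = \<tau> + of_int (- round (Re \<tau>))"
      have \<sigma>: "Im \<sigma> = Im \<tau>" "h \<sigma> = h \<tau>"
        using T_int[OF Suc.prems(1), of "- round (Re \<tau>)"] by (auto simp: \<sigma>_def)
      have "\<bar>Re \<sigma>\<bar> \<le> 1/2"
        using of_int_round_abs_le[of "Re \<tau>"] by (simp add: \<sigma>_def abs_minus_commute)
      then have "\<bar>Re \<sigma>\<bar>\<^sup>2 \<le> (1/2)\<^sup>2" by (intro power_mono) auto
      moreover have "(Im \<sigma>)\<^sup>2 \<le> (1/2)\<^sup>2" using False Suc.prems \<sigma> by (intro power_mono) auto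
      ultimately have le: "(norm \<sigma>)\<^sup>2 \<le> 1/2" unfolding cmod_power2 by (simp add: power_divide)
      have "\<sigma> \<noteq> 0" using \<sigma> Suc.prems by auto
      then have pos: "(norm \<sigma>)\<^sup>2 > 0" by simp
      have "2 * Im \<tau> * (norm \<sigma>)\<^sup>2 \<le> 2 * Im \<tau> * (1/2)"
        using le Suc.prems by (intro mult_left_mono) auto
      then have dbl: "Im (-1 / \<sigma>) \<ge> 2 * Im \<tau>"
        unfolding Im_neg_inverse \<sigma> using pos by (simp add: field_simps)
      have "Im (-1 / \<sigma>) * 2 ^ n \<ge> 2 * Im \<tau> * 2 ^ n"
        using dbl by (intro mult_right_mono) auto
      then have "\<exists>\<tau>'. Im \<tau>' \<ge> 1/2 \<and> h \<tau>' = h (-1 / \<sigma>)"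
        using Suc.prems dbl by (intro Suc.IH) auto
      then show ?thesis using S[of \<sigma>] \<sigma> Suc.prems by auto
    qed auto
  qed
  moreover obtain n where "(1/2) / Im \<tau> < 2 ^ n"
    using real_arch_pow[of 2 "(1/2) / Im \<tau>"] by auto
  then have "Im \<tau> * 2 ^ n \<ge> 1/2" using \<tau> by (simp add: field_simps)
  ultimately show ?thesis using \<tau> by blast
qed

text \<open>The gap between two heights drives the contraction. Every orbit meets Im \<tau> \<ge>
  1/2, so the supremum \<open>M\<close> taken there bounds \<open>h\<close> everywhere, in
  particular on the lower line Im \<tau> = 1/4. The maximum principle started on that line returns a
  bound smaller than \<open>M\<close> on Im \<tau> \<ge> 1/2.\<close>

lemma modular_form_eq_0:
  fixes G :: "complex \<Rightarrow> complex" and K t :: nat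
  assumes hol: "G holomorphic_on upper_half_plane"
    and T: "\<And>\<tau>. Im \<tau> > 0 \<Longrightarrow> G (\<tau> + 1) = G \<tau>"
    and S: "\<And>\<tau>. Im \<tau> > 0 \<Longrightarrow> G (-1 / \<tau>) = \<tau> ^ K * G \<tau>"
    and decay: "\<And>\<tau>. Im \<tau> \<ge> 1/4 \<Longrightarrow> norm (G \<tau>) * exp (pi * real t * Im \<tau>) \<le> C"
    and t: "t \<ge> K" "t > 0" and \<tau>: "Im \<tau> > 0"
  shows "G \<tau> = 0"
proof -
  define h where "h \<tau> = norm (G \<tau>) * sqrt (Im \<tau>) ^ K" for \<tau>
  have hT: "h (\<tau> + 1) = h \<tau>" if "Im \<tau> > 0" for \<tau> using T[OF that] by (simp add: h_def)
  have hS: "h (-1 / \<tau>) = h \<tau>" if "Im \<tau> > 0" for \<tau>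
  proof -
    have "\<tau> \<noteq> 0" using that by auto
    have "sqrt (Im (-1 / \<tau>)) = sqrt (Im \<tau>) / norm \<tau>"
      by (simp only: Im_neg_inverse) (simp add: real_sqrt_divide)
    then have "h (-1 / \<tau>) = norm \<tau> ^ K * norm (G \<tau>) * (sqrt (Im \<tau>) / norm \<tau>) ^ K"
      using S[OF that] by (simp only: h_def norm_mult norm_power)
    then show ?thesis using \<open>\<tau> \<noteq> 0\<close> by (simp add: h_def power_divide)
  qed
  \<comment> \<open>The tangent inequality for exp, with equality at y = 1/4: the growth of
    Im(\<tau>)^(K/2) is measured from the line where the maximum principle starts.\<close>
  have exp_sqrt: "(2 * sqrt y) ^ K \<le> exp (2 * real K * (y - 1/4))" if "y > 0" for y
  proof -
    have "4 * y \<le> exp (4 * y - 1)" using exp_ge_add_one_self[of "4 * y - 1"] by simp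
    also have "\<dots> = (exp (2 * y - 1/2))\<^sup>2" by (simp add: exp_double [symmetric] algebra_simps)
    finally have "sqrt (4 * y) \<le> exp (2 * y - 1/2)" by (intro real_le_lsqrt) auto
    then have "2 * sqrt y \<le> exp (2 * y - 1/2)" by (simp add: real_sqrt_mult)
    then have "(2 * sqrt y) ^ K \<le> exp (2 * y - 1/2) ^ K" using that by (intro power_mono) auto
    then show ?thesis by (simp add: exp_of_nat_mult [symmetric] algebra_simps)
  qed
  have C0: "C \<ge> 0" using decay[of \<i>] by (simp add: order_trans[rotated])
  have h0: "h \<tau> \<ge> 0" if "Im \<tau> > 0" for \<tau> using that by (simp add: h_def)
  \<comment> \<open>Needed only to make the supremum finite; \<open>C\<close> does not enter the
    contracted bound.\<close>
  have h_le: "h \<tau> \<le> C" if "Im \<tau> \<ge> 1/2" for \<tau>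
  proof -
    have "sqrt (Im \<tau>) ^ K \<le> (2 * sqrt (Im \<tau>)) ^ K" using that by (intro power_mono) auto
    also have "\<dots> \<le> exp (2 * real K * (Im \<tau> - 1/4))" using that by (intro exp_sqrt) auto
    also have "2 * real K * (Im \<tau> - 1/4) \<le> pi * real t * Im \<tau>"
      using that t pi_gt3 by (intro mult_mono) auto
    finally have "sqrt (Im \<tau>) ^ K \<le> exp (pi * real t * Im \<tau>)" by simp
    then have "h \<tau> \<le> norm (G \<tau>) * exp (pi * real t * Im \<tau>)"
      unfolding h_def by (intro mult_left_mono) auto
    then show ?thesis using decay[of \<tau>] that by simp
  qed
  define M where "M = Sup (h ` {\<tau>. Im \<tau> \<ge> 1/2})"
  have bdd: "bdd_above (h ` {\<tau>. Im \<tau> \<ge> 1/2})" using h_le by (auto intro!: bdd_aboveI)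
  have hM: "h \<tau> \<le> M" if "Im \<tau> > 0" for \<tau>
  proof -
    have "\<exists>\<tau>'. Im \<tau>' \<ge> 1/2 \<and> h \<tau>' = h \<tau>"
      by (rule modular_invariant_reduce) (fact hT hS that)+
    then obtain \<tau>' where "Im \<tau>' \<ge> 1/2" "h \<tau>' = h \<tau>" by blast
    then show ?thesis unfolding M_def using bdd by (metis cSUP_upper mem_Collect_eq)
  qed
  have M0: "M \<ge> 0" using hM[of \<i>] h0[of \<i>] by simp
  have contract: "h \<tau> \<le> exp (- (1/4)) * M" if \<tau>: "Im \<tau> \<ge> 1/2" for \<tau>
  proof -
    \<comment> \<open>This is G q^(-t); the hypothesis \<open>decay\<close> says that it is bounded
      on the half plane Im \<tau> \<ge> 1/4.\<close>
    define \<phi> where "\<phi> \<tau> = G \<tau> * exp (- (of_real (pi * real t) * \<i> * \<tau>))" for \<tau>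
    have norm_\<phi>: "norm (\<phi> \<tau>) = norm (G \<tau>) * exp (pi * real t * Im \<tau>)" for \<tau>
      by (simp add: \<phi>_def norm_mult)
    have "norm (\<phi> \<tau>) \<le> 2 ^ K * M * exp (pi * real t * (1/4))"
    proof (rule phragmen_lindelof_halfplane[of \<phi> 0 "1/4" C])
      show "\<phi> holomorphic_on {z. Im z > 0}"
        unfolding \<phi>_def by (intro holomorphic_intros hol)
      fix z :: complex assume z: "Im z = 1/4"
      have "norm (G z) = 2 ^ K * h z"
        by (simp add: h_def z real_sqrt_divide power_divide)
      also have "\<dots> \<le> 2 ^ K * M" using hM[of z] z by simp
      finally show "norm (\<phi> z) \<le> 2 ^ K * M * exp (pi * real t * (1/4))"
        unfolding norm_\<phi> z by (intro mult_right_mono) auto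
    qed (use \<tau> decay in \<open>auto simp: norm_\<phi>\<close>)
    then have "norm (G \<tau>) \<le> 2 ^ K * M * exp (pi * real t * (1/4)) / exp (pi * real t * Im \<tau>)"
      by (simp add: norm_\<phi> field_simps)
    also have "\<dots> = 2 ^ K * M * exp (- (pi * real t * (Im \<tau> - 1/4)))"
      unfolding times_divide_eq_right [symmetric] exp_diff [symmetric] by (simp add: algebra_simps)
    finally have "h \<tau> \<le> 2 ^ K * M * exp (- (pi * real t * (Im \<tau> - 1/4))) * sqrt (Im \<tau>) ^ K"
      unfolding h_def using \<tau> by (intro mult_right_mono) auto
    also have "\<dots> = M * exp (- (pi * real t * (Im \<tau> - 1/4))) * (2 * sqrt (Im \<tau>)) ^ K"
      by (simp add: power_mult_distrib mult_ac)
    also have "\<dots> \<le> M * exp (- (pi * real t * (Im \<tau> - 1/4))) * exp (2 * real K * (Im \<tau> - 1/4))"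
      using M0 \<tau> by (intro mult_left_mono exp_sqrt) auto
    also have "\<dots> = M * exp (- ((pi * real t - 2 * real K) * (Im \<tau> - 1/4)))"
      unfolding mult.assoc[of M] exp_add [symmetric] by (simp add: algebra_simps)
    also have "\<dots> \<le> M * exp (- (1/4))"
    proof -
      \<comment> \<open>With pi > 3 and t \<ge> K, the rate pi t - 2K is at least t \<ge> 1, and Im
        \<tau> - 1/4 is at least 1/4: hence the factor exp(-1/4).\<close>
      have "pi * real t \<ge> 3 * real t" using pi_gt3 by (intro mult_right_mono) auto
      then have "1 \<le> pi * real t - 2 * real K" using t by linarith
      then have "1 * (1/4) \<le> (pi * real t - 2 * real K) * (Im \<tau> - 1/4)"
        using \<tau> by (intro mult_mono) auto
      then show ?thesis using M0 by (intro mult_left_mono) auto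
    qed
    finally show ?thesis by (simp add: mult.commute)
  qed
  have "Sup (h ` {\<tau>. Im \<tau> \<ge> 1/2}) \<le> exp (- (1/4)) * M"
  proof (rule cSUP_least)
    have "\<i> \<in> {\<tau>. Im \<tau> \<ge> 1/2}" by simp
    then show "{\<tau>. Im \<tau> \<ge> 1/2} \<noteq> {}" by blast
  qed (use contract in blast)
  then have "M \<le> exp (- (1/4)) * M" unfolding M_def .
  then have "(1 - exp (- (1/4))) * M \<le> 0" by (simp add: algebra_simps)
  moreover have "1 - exp (- (1/4)) > (0::real)" by simp
  ultimately have "M \<le> 0" by (simp only: mult_le_0_iff) linarith
  then have "M = 0" using M0 by simp
  then have "h \<tau> = 0" using hM[OF \<tau>] h0[OF \<tau>] by simp
  then show ?thesis using \<tau> by (simp add: h_def)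
qed

text \<open>The slash operators return 0 off the upper half plane, so that they are injective on families
  of functions vanishing there.\<close>

definition slash_S :: "nat \<Rightarrow> (complex \<Rightarrow> complex) \<Rightarrow> complex \<Rightarrow> complex" where
  "slash_S k f \<tau> = (if Im \<tau> > 0 then f (-1 / \<tau>) / \<tau> ^ k else 0)"

definition slash_T :: "(complex \<Rightarrow> complex) \<Rightarrow> complex \<Rightarrow> complex" where
  "slash_T f \<tau> = (if Im \<tau> > 0 then f (\<tau> + 1) else 0)"

lemma inj_on_slash_S:
  assumes "\<forall>f\<in>W. \<forall>\<tau>. Im \<tau> \<le> 0 \<longrightarrow> f \<tau> = 0"
  shows "inj_on (slash_S k) W"
proof (rule inj_onI, rule ext)
  fix f g \<tau> assume fg: "f \<in> W" "g \<in> W" "slash_S k f = slash_S k g"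
  show "f \<tau> = g \<tau>"
  proof (cases "Im \<tau> > 0")
    case True
    then have "\<tau> \<noteq> 0" by auto
    then have "Im (-1 / \<tau>) > 0" using True unfolding Im_neg_inverse by simp
    then show ?thesis using fun_cong[OF fg(3), of "-1 / \<tau>"] \<open>\<tau> \<noteq> 0\<close> by (simp add: slash_S_def)
  next
    case False
    then have "Im \<tau> \<le> 0" by simp
    then show ?thesis using fg(1,2) assms by metis
  qed
qed

lemma inj_on_slash_T:
  assumes "\<forall>f\<in>W. \<forall>\<tau>. Im \<tau> \<le> 0 \<longrightarrow> f \<tau> = 0"
  shows "inj_on slash_T W"
proof (rule inj_onI, rule ext)
  fix f g \<tau> assume fg: "f \<in> W" "g \<in> W" "slash_T f = slash_T g"
  show "f \<tau> = g \<tau>"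
  proof (cases "Im \<tau> > 0")
    case True
    then show ?thesis using fun_cong[OF fg(3), of "\<tau> - 1"] by (simp add: slash_T_def)
  next
    case False
    then have "Im \<tau> \<le> 0" by simp
    then show ?thesis using fg(1,2) assms by metis
  qed
qed

text \<open>On a finite set the injective slash operators are permutations, so the product over
  \<open>W\<close> is modular of weight \<open>k * card W\<close> and inherits the decay of
  \<open>f0\<close> because the other factors are bounded. A zero product only reveals some zero
  factor, not which one.\<close>

lemma slash_closed_family_contains_0:
  fixes W :: "(complex \<Rightarrow> complex) set" and k t :: nat
  assumes fin: "finite W"
    and hol: "\<And>f. f \<in> W \<Longrightarrow> f holomorphic_on upper_half_plane"
    and supp: "\<forall>f\<in>W. \<forall>\<tau>. Im \<tau> \<le> 0 \<longrightarrow> f \<tau> = 0"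
    and S: "\<And>f. f \<in> W \<Longrightarrow> slash_S k f \<in> W"
    and T: "\<And>f. f \<in> W \<Longrightarrow> slash_T f \<in> W"
    and bdd: "\<And>f. f \<in> W \<Longrightarrow> \<exists>B. \<forall>\<tau>. Im \<tau> \<ge> 1/4 \<longrightarrow> norm (f \<tau>) \<le> B"
    and f0: "f0 \<in> W" "\<And>\<tau>. Im \<tau> \<ge> 1/4 \<Longrightarrow> norm (f0 \<tau>) * exp (pi * real t * Im \<tau>) \<le> C"
    and t: "t \<ge> k * card W" "t > 0"
  shows "\<exists>f\<in>W. \<forall>\<tau>. Im \<tau> > 0 \<longrightarrow> f \<tau> = 0"
proof -
  define G where "G \<tau> = (\<Prod>f\<in>W. f \<tau>)" for \<tau>
  have imS: "slash_S k ` W = W"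
    using fin S inj_on_slash_S[OF supp] by (intro endo_inj_surj) auto
  have imT: "slash_T ` W = W"
    using fin T inj_on_slash_T[OF supp] by (intro endo_inj_surj) auto
  have GS: "G (-1 / \<tau>) = \<tau> ^ (k * card W) * G \<tau>" if "Im \<tau> > 0" for \<tau>
  proof -
    have "\<tau> \<noteq> 0" using that by auto
    have "G \<tau> = (\<Prod>f\<in>slash_S k ` W. f \<tau>)" by (simp add: G_def imS)
    also have "\<dots> = (\<Prod>f\<in>W. f (-1 / \<tau>) / \<tau> ^ k)"
      using that inj_on_slash_S[OF supp] by (subst prod.reindex) (auto simp: slash_S_def)
    also have "\<dots> = G (-1 / \<tau>) / \<tau> ^ (k * card W)"
      by (simp add: G_def prod_dividef power_mult)
    finally show ?thesis using \<open>\<tau> \<noteq> 0\<close> by simp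
  qed
  have GT: "G (\<tau> + 1) = G \<tau>" if "Im \<tau> > 0" for \<tau>
  proof -
    have "G \<tau> = (\<Prod>f\<in>slash_T ` W. f \<tau>)" by (simp add: G_def imT)
    also have "\<dots> = G (\<tau> + 1)"
      using that inj_on_slash_T[OF supp] by (subst prod.reindex) (auto simp: slash_T_def G_def)
    finally show ?thesis ..
  qed
  obtain B where B: "\<And>f \<tau>. f \<in> W \<Longrightarrow> Im \<tau> \<ge> 1/4 \<Longrightarrow> norm (f \<tau>) \<le> B f"
    using bdd by metis
  have decay: "norm (G \<tau>) * exp (pi * real t * Im \<tau>) \<le> C * (\<Prod>f\<in>W - {f0}. B f)" if "Im \<tau> \<ge> 1/4" for \<tau>
  proof -
    have "norm (G \<tau>) * exp (pi * real t * Im \<tau>) =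
        (norm (f0 \<tau>) * exp (pi * real t * Im \<tau>)) * (\<Prod>f\<in>W - {f0}. norm (f \<tau>))"
      using fin f0(1) by (simp add: G_def prod.remove norm_mult prod_norm)
    also have "\<dots> \<le> C * (\<Prod>f\<in>W - {f0}. B f)"
    proof (rule mult_mono)
      show "(\<Prod>f\<in>W - {f0}. norm (f \<tau>)) \<le> (\<Prod>f\<in>W - {f0}. B f)"
        using B that by (intro prod_mono) auto
      show "norm (f0 \<tau>) * exp (pi * real t * Im \<tau>) \<le> C" using f0 that by blast
      then show "0 \<le> C" by (rule order_trans[rotated]) simp
    qed (auto intro: prod_nonneg)
    finally show ?thesis .
  qed
  have "G holomorphic_on upper_half_plane"
    unfolding G_def by (intro holomorphic_on_prod hol)
  then have "G \<tau> = 0" if "Im \<tau> > 0" for \<tau>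
    using modular_form_eq_0[OF _ GT GS decay t that] by blast
  moreover have "\<i> \<in> upper_half_plane" by simp
  then have "upper_half_plane \<noteq> {}" by blast
  ultimately show ?thesis
    using holomorphic_prod_eq_0[OF fin hol open_halfspace_Im_gt connected_upper_half_plane]
    by (simp add: G_def)
qed

section \<open>Theta functions\<close>

text \<open>The expansion of theta3(l \<tau>), for l \<ge> 1, in the nome of \<tau> rather than of l
  \<tau>, so that different l share one variable. The exponents are distinct, hence all coefficients
  are 0, 1 or 2.\<close>

definition theta_fps :: "nat \<Rightarrow> complex fps" where
  "theta_fps l = Abs_fps (\<lambda>n. if n = 0 then 1 else if n \<in> range (\<lambda>\<nu>. l * (Suc \<nu>)\<^sup>2) then 2 else 0)"

lemma fps_conv_radius_theta_fps: "fps_conv_radius (theta_fps l) \<ge> 1"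
  unfolding fps_conv_radius_def
proof (rule conv_radius_geI_ex)
  fix r :: real assume r: "0 < r" "ereal r < 1"
  have "summable (\<lambda>n. fps_nth (theta_fps l) n * of_real r ^ n)"
  proof (rule summable_comparison_test')
    show "summable (\<lambda>n. 2 * r ^ n)" using r by (intro summable_mult summable_geometric) auto
    show "norm (fps_nth (theta_fps l) n * of_real r ^ n) \<le> 2 * r ^ n" for n
      using r by (auto simp: theta_fps_def norm_mult norm_power)
  qed
  then show "\<exists>z. norm z = r \<and> summable (\<lambda>n. fps_nth (theta_fps l) n * z ^ n)"
    using r by (intro exI[of _ "of_real r"]) auto
qed

lemma norm_less_theta_fps_radius: "norm z < 1 \<Longrightarrow> ereal (norm z) < fps_conv_radius (theta_fps l)"
  using fps_conv_radius_theta_fps[of l] by (metis ereal_less(3) less_le_trans)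

lemma eval_theta_fps:
  assumes w: "norm w < 1" and l: "l \<ge> 1"
  shows "summable (\<lambda>\<nu>. w ^ (l * (Suc \<nu>)\<^sup>2))"
    and "eval_fps (theta_fps l) w = 1 + 2 * (\<Sum>\<nu>. w ^ (l * (Suc \<nu>)\<^sup>2))"
proof -
  define g where "g \<nu> = l * (Suc \<nu>)\<^sup>2" for \<nu>
  have mono: "strict_mono g"
    unfolding strict_mono_Suc_iff g_def using l
    by (intro allI mult_strict_left_mono power_strict_mono) auto
  have g0: "0 \<notin> range g" using l by (auto simp: g_def)
  define f where "f n = (if n \<in> range g then 2 * w ^ n else 0)" for n
  have "(\<lambda>n. fps_nth (theta_fps l) n * w ^ n) sums eval_fps (theta_fps l) w"
    by (rule sums_eval_fps[OF norm_less_theta_fps_radius[OF w]])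
  moreover have "(\<lambda>n. if n = 0 then 1 else 0 :: complex) sums 1"
    using sums_single[of 0 "\<lambda>_. 1::complex"] by simp
  \<comment> \<open>The constant term is split off because 0 is not an exponent in
    \<open>range g\<close>; the rest is reindexed along the strictly increasing
    \<open>g\<close>.\<close>
  ultimately have "(\<lambda>n. fps_nth (theta_fps l) n * w ^ n - (if n = 0 then 1 else 0)) sums
      (eval_fps (theta_fps l) w - 1)" by (rule sums_diff)
  also have "(\<lambda>n. fps_nth (theta_fps l) n * w ^ n - (if n = 0 then 1 else 0)) = f"
    using g0 by (auto simp: f_def theta_fps_def g_def fun_eq_iff)
  finally have "f sums (eval_fps (theta_fps l) w - 1)" .
  then have "(\<lambda>\<nu>. f (g \<nu>)) sums (eval_fps (theta_fps l) w - 1)"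
    by (subst sums_mono_reindex[OF mono]) (auto simp: f_def)
  then have "(\<lambda>\<nu>. 2 * w ^ g \<nu>) sums (eval_fps (theta_fps l) w - 1)" by (simp add: f_def)
  from sums_mult[OF this, of "1/2"]
  have *: "(\<lambda>\<nu>. w ^ g \<nu>) sums ((eval_fps (theta_fps l) w - 1) / 2)" by simp
  then show "summable (\<lambda>\<nu>. w ^ (l * (Suc \<nu>)\<^sup>2))" by (auto simp: g_def sums_iff)
  from * have "(\<Sum>\<nu>. w ^ (l * (Suc \<nu>)\<^sup>2)) = (eval_fps (theta_fps l) w - 1) / 2"
    unfolding g_def by (rule sums_unique [symmetric])
  then have "2 * (\<Sum>\<nu>. w ^ (l * (Suc \<nu>)\<^sup>2)) = eval_fps (theta_fps l) w - 1" by (simp add: mult.commute)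
  then show "eval_fps (theta_fps l) w = 1 + 2 * (\<Sum>\<nu>. w ^ (l * (Suc \<nu>)\<^sup>2))"
    by (simp only:) simp
qed

lemma norm_nome: "norm (nome \<tau>) = exp (- (pi * Im \<tau>))"
  by (simp add: nome_def)

lemma norm_nome_less_1: "Im \<tau> > 0 \<Longrightarrow> norm (nome \<tau>) < 1"
  by (simp add: norm_nome)

lemma nome_add: "nome (\<sigma> + \<tau>) = nome \<sigma> * nome \<tau>"
  by (simp add: nome_def ring_distribs exp_add)

lemma nome_of_nat_mult: "nome (of_nat n * \<tau>) = nome \<tau> ^ n"
  unfolding nome_def by (subst exp_of_nat_mult [symmetric]) (simp add: mult_ac)

lemma nome_1: "nome 1 = -1" and nome_2: "nome 2 = 1"
proof -
  show 1: "nome 1 = -1" using exp_pi_i by (simp add: nome_def mult.commute)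
  show "nome 2 = 1" using nome_add[of 1 1] 1 by simp
qed

lemma theta3_eq_eval_fps:
  assumes "Im \<tau> > 0" "l \<ge> 1"
  shows "theta3 (of_nat l * \<tau>) = eval_fps (theta_fps l) (nome \<tau>)"
  using eval_theta_fps(2)[OF norm_nome_less_1 assms(2)] assms
  by (simp add: theta3_def nome_of_nat_mult power_mult [symmetric])

lemma summable_theta3: "norm w < 1 \<Longrightarrow> summable (\<lambda>\<nu>. w ^ (Suc \<nu>)\<^sup>2 :: complex)"
  using eval_theta_fps(1)[of w 1] by simp

lemma holomorphic_theta3: "theta3 holomorphic_on upper_half_plane"
proof -
  have "(\<lambda>\<tau>. eval_fps (theta_fps 1) (nome \<tau>)) holomorphic_on upper_half_plane"
  proof (rule holomorphic_on_compose_gen[of nome _ "eval_fps (theta_fps 1)" "ball 0 1", unfolded o_def])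
    show "nome holomorphic_on upper_half_plane" unfolding nome_def by (intro holomorphic_intros)
    show "eval_fps (theta_fps 1) holomorphic_on ball 0 1"
      using norm_less_theta_fps_radius by (intro holomorphic_on_eval_fps) auto
    show "nome ` upper_half_plane \<subseteq> ball 0 1" using norm_nome_less_1 by auto
  qed
  then show ?thesis
    by (rule holomorphic_transform) (use theta3_eq_eval_fps[of _ 1] in auto)
qed

text \<open>The nome maps the unbounded region Im \<tau> \<ge> y into a compact disc inside the disc
  of convergence.\<close>

lemma bounded_theta3:
  assumes "y > 0"
  shows "\<exists>B. \<forall>\<tau>. Im \<tau> \<ge> y \<longrightarrow> norm (theta3 \<tau>) \<le> B"
proof -
  define r where "r = exp (- (pi * y))"
  have r: "r < 1" using assms by (simp add: r_def)
  have "cball (0::complex) r \<subseteq> eball 0 (fps_conv_radius (theta_fps 1))"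
  proof
    fix z :: complex assume "z \<in> cball 0 r"
    then show "z \<in> eball 0 (fps_conv_radius (theta_fps 1))"
      using norm_less_theta_fps_radius[of z 1] r by simp
  qed
  then have "eval_fps (theta_fps 1) holomorphic_on cball 0 r"
    by (rule holomorphic_on_eval_fps)
  then have "continuous_on (cball 0 r) (eval_fps (theta_fps 1))"
    by (rule holomorphic_on_imp_continuous_on)
  then have "bounded (eval_fps (theta_fps 1) ` cball 0 r)"
    by (intro compact_imp_bounded compact_continuous_image) auto
  then obtain B where B: "\<And>w. w \<in> cball 0 r \<Longrightarrow> norm (eval_fps (theta_fps 1) w) \<le> B"
    unfolding bounded_iff by blast
  have "norm (theta3 \<tau>) \<le> B" if "Im \<tau> \<ge> y" for \<tau>
  proof -
    have "nome \<tau> \<in> cball 0 r" using that by (simp add: norm_nome r_def)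
    then show ?thesis using B[of "nome \<tau>"] theta3_eq_eval_fps[of \<tau> 1] that assms by simp
  qed
  then show ?thesis by blast
qed

lemma theta3_add_2: "theta3 (\<tau> + 2) = theta3 \<tau>"
  by (simp add: theta3_def nome_add nome_2)

lemma minus_power_square: "(- w) ^ (n\<^sup>2) = (if even n then w ^ (n\<^sup>2) else - (w ^ (n\<^sup>2)) :: complex)"
  by (auto simp: power_minus_even power_minus_odd)

text \<open>The shift replaces q by -q: odd indices cancel and an even index 2k contributes twice
  q^(4k^2).\<close>

lemma theta3_add_1:
  assumes "Im \<tau> > 0"
  shows "theta3 \<tau> + theta3 (\<tau> + 1) = 2 * theta3 (4 * \<tau>)"
proof -
  define w where "w = nome \<tau>"
  have w: "norm w < 1" using assms by (simp add: w_def norm_nome_less_1)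
  have "(\<Sum>\<nu>. w ^ (Suc \<nu>)\<^sup>2) + (\<Sum>\<nu>. (- w) ^ (Suc \<nu>)\<^sup>2) = (\<Sum>\<nu>. w ^ (Suc \<nu>)\<^sup>2 + (- w) ^ (Suc \<nu>)\<^sup>2)"
    using summable_theta3[of w] summable_theta3[of "- w"] w by (intro suminf_add) auto
  \<comment> \<open>The series is indexed from 0, so the position 2\<mu> + 1 carries the even number
    2(\<mu> + 1).\<close>
  also have "\<dots> = (\<Sum>\<mu>. w ^ (Suc (2 * \<mu> + 1))\<^sup>2 + (- w) ^ (Suc (2 * \<mu> + 1))\<^sup>2)"
  proof (rule suminf_mono_reindex[symmetric])
    show "strict_mono (\<lambda>\<mu>::nat. 2 * \<mu> + 1)" by (auto simp: strict_mono_def)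
    fix n :: nat assume "n \<notin> range (\<lambda>\<mu>. 2 * \<mu> + 1)"
    then have "even n" by (metis oddE rangeI)
    then show "w ^ (Suc n)\<^sup>2 + (- w) ^ (Suc n)\<^sup>2 = 0" by (simp add: minus_power_square)
  qed
  also have "\<dots> = (\<Sum>\<mu>. 2 * w ^ (4 * (Suc \<mu>)\<^sup>2))"
  proof (rule suminf_cong)
    fix \<mu> :: nat
    have 1: "(Suc (2 * \<mu> + 1))\<^sup>2 = 4 * (Suc \<mu>)\<^sup>2" and 2: "even (Suc (2 * \<mu> + 1))"
      by (auto simp: power2_eq_square)
    have "(- w) ^ (Suc (2 * \<mu> + 1))\<^sup>2 = w ^ (Suc (2 * \<mu> + 1))\<^sup>2"
      using minus_power_square[of w "Suc (2 * \<mu> + 1)"] 2 by (simp only: if_True)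
    then show "w ^ (Suc (2 * \<mu> + 1))\<^sup>2 + (- w) ^ (Suc (2 * \<mu> + 1))\<^sup>2 = 2 * w ^ (4 * (Suc \<mu>)\<^sup>2)"
      unfolding 1 by simp
  qed
  also have "\<dots> = 2 * (\<Sum>\<mu>. w ^ (4 * (Suc \<mu>)\<^sup>2))"
    using eval_theta_fps(1)[OF w, of 4] by (intro suminf_mult) simp
  finally have sum: "(\<Sum>\<nu>. w ^ (Suc \<nu>)\<^sup>2) + (\<Sum>\<nu>. (- w) ^ (Suc \<nu>)\<^sup>2) = 2 * (\<Sum>\<mu>. w ^ (4 * (Suc \<mu>)\<^sup>2))" .
  have "nome (\<tau> + 1) = - w" by (simp add: nome_add nome_1 w_def)
  then have "theta3 \<tau> + theta3 (\<tau> + 1) = 2 + 2 * ((\<Sum>\<nu>. w ^ (Suc \<nu>)\<^sup>2) + (\<Sum>\<nu>. (- w) ^ (Suc \<nu>)\<^sup>2))"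
    by (simp add: theta3_def w_def)
  also note sum
  also have "nome (4 * \<tau>) = w ^ 4" using nome_of_nat_mult[of 4 \<tau>] by (simp add: w_def)
  then have "2 + 2 * (2 * (\<Sum>\<mu>. w ^ (4 * (Suc \<mu>)\<^sup>2))) = 2 * theta3 (4 * \<tau>)"
    by (simp add: theta3_def power_mult [symmetric])
  finally show ?thesis .
qed

section \<open>Theta constants under the generators of the modular group\<close>

definition theta4 :: "complex \<Rightarrow> complex" where "theta4 \<tau> = theta3 (\<tau> + 1)"
text \<open>The classical series 2 q^(1/4) + 2 q^(9/4) + ...: the even indices of theta3(\<tau>/4)
  form theta3(\<tau>), and their removal leaves the odd ones.\<close>

definition theta2 :: "complex \<Rightarrow> complex" where "theta2 \<tau> = theta3 (\<tau> / 4) - theta3 \<tau>"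

text \<open>By \<open>theta3_add_1\<close> at \<tau>/4. The difference doubles odd indices and kills
  even ones, which avoids reindexing over the odd numbers.\<close>

lemma theta2_eq_suminf:
  assumes "Im \<tau> > 0"
  shows "summable (\<lambda>\<nu>. nome (\<tau> / 4) ^ (Suc \<nu>)\<^sup>2 - (- nome (\<tau> / 4)) ^ (Suc \<nu>)\<^sup>2)"
    and "theta2 \<tau> = (\<Sum>\<nu>. nome (\<tau> / 4) ^ (Suc \<nu>)\<^sup>2 - (- nome (\<tau> / 4)) ^ (Suc \<nu>)\<^sup>2)"
proof -
  define w where "w = nome (\<tau> / 4)"
  have w: "norm w < 1" using assms by (simp add: w_def norm_nome_less_1)
  have s: "summable (\<lambda>\<nu>. w ^ (Suc \<nu>)\<^sup>2)" "summable (\<lambda>\<nu>. (- w) ^ (Suc \<nu>)\<^sup>2)"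
    using w by (auto intro!: summable_theta3)
  show "summable (\<lambda>\<nu>. nome (\<tau> / 4) ^ (Suc \<nu>)\<^sup>2 - (- nome (\<tau> / 4)) ^ (Suc \<nu>)\<^sup>2)"
    using summable_diff[OF s] by (simp add: w_def)
  have "2 * theta2 \<tau> = theta3 (\<tau> / 4) - theta3 (\<tau> / 4 + 1)"
    using theta3_add_1[of "\<tau> / 4"] assms by (simp add: theta2_def algebra_simps)
  also have "\<dots> = 2 * ((\<Sum>\<nu>. w ^ (Suc \<nu>)\<^sup>2) - (\<Sum>\<nu>. (- w) ^ (Suc \<nu>)\<^sup>2))"
    by (simp add: theta3_def nome_add nome_1 w_def algebra_simps)
  finally have "theta2 \<tau> = (\<Sum>\<nu>. w ^ (Suc \<nu>)\<^sup>2) - (\<Sum>\<nu>. (- w) ^ (Suc \<nu>)\<^sup>2)"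
    by (simp only: mult_cancel_left) auto
  then show "theta2 \<tau> = (\<Sum>\<nu>. nome (\<tau> / 4) ^ (Suc \<nu>)\<^sup>2 - (- nome (\<tau> / 4)) ^ (Suc \<nu>)\<^sup>2)"
    using suminf_diff[OF s] by (simp add: w_def)
qed

lemma odd_square_mod_8:
  assumes "odd (n::nat)"
  shows "\<exists>c. n\<^sup>2 = 8 * c + 1"
proof -
  obtain b where b: "n = 2 * b + 1" using assms by (elim oddE)
  have "even (b * (b + 1))" by simp
  then obtain c where "b * (b + 1) = 2 * c" by (elim evenE)
  then have "n\<^sup>2 = 8 * c + 1" by (simp add: b power2_eq_square algebra_simps)
  then show ?thesis by blast
qed

text \<open>The shift multiplies the nome of \<tau>/4 by an eighth root of unity \<omega>. Odd
  squares are 1 modulo 8, so every surviving term acquires the same factor \<omega>.\<close>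

lemma theta2_add_1:
  assumes "Im \<tau> > 0"
  shows "theta2 (\<tau> + 1) ^ 8 = theta2 \<tau> ^ 8"
proof -
  define \<omega> where "\<omega> = nome (1 / 4)"
  have \<omega>8: "\<omega> ^ 8 = 1" using nome_of_nat_mult[of 8 "1/4"] nome_2 by (simp add: \<omega>_def)
  define w where "w = nome (\<tau> / 4)"
  have w': "nome ((\<tau> + 1) / 4) = \<omega> * w"
    by (simp add: add_divide_distrib nome_add \<omega>_def w_def)
  have "theta2 (\<tau> + 1) = (\<Sum>\<nu>. (\<omega> * w) ^ (Suc \<nu>)\<^sup>2 - (- (\<omega> * w)) ^ (Suc \<nu>)\<^sup>2)"
    using theta2_eq_suminf(2)[of "\<tau> + 1"] assms by (simp add: w')
  also have "\<dots> = (\<Sum>\<nu>. \<omega> * (w ^ (Suc \<nu>)\<^sup>2 - (- w) ^ (Suc \<nu>)\<^sup>2))"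
  proof (rule suminf_cong)
    fix \<nu> :: nat
    show "(\<omega> * w) ^ (Suc \<nu>)\<^sup>2 - (- (\<omega> * w)) ^ (Suc \<nu>)\<^sup>2 = \<omega> * (w ^ (Suc \<nu>)\<^sup>2 - (- w) ^ (Suc \<nu>)\<^sup>2)"
    proof (cases "odd (Suc \<nu>)")
      case True
      then obtain c where "(Suc \<nu>)\<^sup>2 = 8 * c + 1" using odd_square_mod_8 by blast
      then have "\<omega> ^ (Suc \<nu>)\<^sup>2 = \<omega>" by (simp add: power_add power_mult \<omega>8)
      then show ?thesis using True by (simp add: minus_power_square power_mult_distrib del: power_Suc even_Suc)
    next
      case False
      then show ?thesis by (simp add: minus_power_square del: power_Suc even_Suc)
    qed
  qed
  also have "\<dots> = \<omega> * theta2 \<tau>"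
    using theta2_eq_suminf[OF assms] by (subst suminf_mult) (auto simp: w_def)
  finally show ?thesis by (simp add: power_mult_distrib \<omega>8)
qed

lemma theta3_imaginary_axis:
  assumes x: "x > 0"
  shows "theta3 (\<i> * of_real (1 / x)) = of_real (sqrt x) * theta3 (\<i> * of_real x)"
proof -
  have real: "theta3 (\<i> * of_real y) = of_real (1 + 2 * (\<Sum>k. exp (- (pi * y * (real (Suc k))\<^sup>2))))" if "y > 0" for y
  proof -
    have e: "nome (\<i> * of_real y) = of_real (exp (- (pi * y)))"
    proof -
      have "of_real pi * \<i> * (\<i> * of_real y) = complex_of_real (- (pi * y))"
        by (simp add: complex_eq_iff)
      then show ?thesis by (simp only: nome_def exp_of_real)
    qed
    have p: "exp (- (pi * y)) ^ (Suc k)\<^sup>2 = exp (- (pi * y * (real (Suc k))\<^sup>2))" for k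
      by (subst exp_of_nat_mult [symmetric]) (simp add: mult_ac)
    have "summable (\<lambda>k. of_real (exp (- (pi * y)) ^ (Suc k)\<^sup>2) :: complex)"
      using summable_theta3[of "of_real (exp (- (pi * y)))"] that by simp
    then have "summable (\<lambda>k. exp (- (pi * y)) ^ (Suc k)\<^sup>2)" by (simp only: summable_of_real_iff)
    then have "(\<Sum>k. of_real (exp (- (pi * y)) ^ (Suc k)\<^sup>2)) = (of_real (\<Sum>k. exp (- (pi * y)) ^ (Suc k)\<^sup>2) :: complex)"
      by (rule suminf_of_real [symmetric])
    then show ?thesis unfolding theta3_def e p [symmetric] by simp
  qed
  have "1 + 2 * (\<Sum>k. exp (- (pi * x * (real (Suc k))\<^sup>2))) =
           1 / sqrt x * (1 + 2 * (\<Sum>j. exp (- (pi * (1 / x) * (real (Suc j))\<^sup>2))))"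
    \<comment> \<open>With s = x / pi the exponents pi^2 s and 1/s become pi x and pi / x.\<close>
    using theta_sum_inversion[of "x / pi"] x by (simp add: power2_eq_square mult_ac del: of_nat_Suc)
  then have "1 + 2 * (\<Sum>j. exp (- (pi * (1 / x) * (real (Suc j))\<^sup>2))) =
      sqrt x * (1 + 2 * (\<Sum>k. exp (- (pi * x * (real (Suc k))\<^sup>2))))" using x by simp
  then show ?thesis using x by (simp only: real zero_less_divide_1_iff of_real_mult)
qed

lemma Im_neg_inverse_pos: "Im \<tau> > 0 \<Longrightarrow> Im (-1 / \<tau>) > 0"
  unfolding Im_neg_inverse by (auto intro!: divide_pos_pos)

text \<open>On the half plane -i \<tau> has positive real part, so the principal root is holomorphic
  and equals sqrt x at \<tau> = i x; the identity theorem extends the law from the imaginary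
  axis.\<close>

lemma theta3_inversion:
  assumes "Im \<tau> > 0"
  shows "theta3 (-1 / \<tau>) = csqrt (- \<i> * \<tau>) * theta3 \<tau>"
proof -
  define f where "f \<tau> = theta3 (-1 / \<tau>) - csqrt (- \<i> * \<tau>) * theta3 \<tau>" for \<tau>
  have "f \<tau> = 0"
  proof (rule analytic_continuation[of f upper_half_plane "(\<lambda>x. \<i> * of_real x) ` {0<..}" \<i>])
    have "(\<lambda>\<tau>. theta3 (-1 / \<tau>)) holomorphic_on upper_half_plane"
    proof (rule holomorphic_on_compose_gen[of "\<lambda>\<tau>. -1 / \<tau>" _ theta3 upper_half_plane, unfolded o_def])
      show "(\<lambda>\<tau>. -1 / \<tau>) holomorphic_on upper_half_plane"
        by (intro holomorphic_intros) auto
      show "theta3 holomorphic_on upper_half_plane" by (rule holomorphic_theta3)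
    qed (use Im_neg_inverse_pos in auto)
    then show "f holomorphic_on upper_half_plane"
      unfolding f_def using holomorphic_theta3
      by (intro holomorphic_intros) (auto simp: complex_nonpos_Reals_iff)
    show "\<i> islimpt (\<lambda>x. \<i> * of_real x) ` {0<..}"
      unfolding islimpt_approachable
    proof (intro allI impI)
      fix e :: real assume e: "e > 0"
      have "dist (\<i> * of_real (1 + e / 2)) \<i> = norm (\<i> * of_real (e / 2))"
        by (simp add: dist_norm algebra_simps)
      then have "dist (\<i> * of_real (1 + e / 2)) \<i> < e" using e by (simp add: norm_mult)
      moreover have "\<i> * of_real (1 + e / 2) \<noteq> \<i>" using e by (simp add: complex_eq_iff)
      ultimately show "\<exists>x'\<in>(\<lambda>x. \<i> * of_real x) ` {0<..}. x' \<noteq> \<i> \<and> dist x' \<i> < e"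
        using e by (intro bexI[of _ "\<i> * of_real (1 + e / 2)"] imageI) auto
    qed
    fix z assume "z \<in> (\<lambda>x. \<i> * of_real x) ` {0<..}"
    then obtain x where x: "x > 0" "z = \<i> * of_real x" by auto
    have "-1 / z = \<i> * of_real (1 / x)" unfolding x(2) using x(1) by (simp add: field_simps)
    moreover have "- \<i> * z = of_real x" using x by simp
    moreover have "csqrt (of_real x) = of_real (sqrt x)" using x by simp
    ultimately show "f z = 0"
      using theta3_imaginary_axis[OF x(1)] x by (simp only: f_def) simp
  qed (use assms connected_upper_half_plane open_halfspace_Im_gt in auto)
  then show ?thesis by (simp add: f_def)
qed

lemma csqrt_4_mult: "csqrt (4 * z) = 2 * csqrt z"
proof (cases "z = 0")
  case False
  show ?thesis
  proof (rule csqrt_unique)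
    show "(2 * csqrt z)\<^sup>2 = 4 * z" by (simp add: power_mult_distrib)
    show "0 < Re (2 * csqrt z) \<or> Re (2 * csqrt z) = 0 \<and> 0 \<le> Im (2 * csqrt z)"
      using csqrt_principal[of z] by auto
  qed
qed simp

text \<open>Inverting \<open>theta3\<close> at both \<tau> and 4 \<tau> yields 2 theta3(4 \<tau>) -
  theta3(\<tau>), which is \<open>theta4\<close> by \<open>theta3_add_1\<close>. Thus inversion
  exchanges \<open>theta2\<close> and \<open>theta4\<close>.\<close>

lemma theta2_inversion:
  assumes "Im \<tau> > 0"
  shows "theta2 (-1 / \<tau>) = csqrt (- \<i> * \<tau>) * theta4 \<tau>"
proof -
  have "-1 / \<tau> / 4 = -1 / (4 * \<tau>)" by simp
  then have "theta2 (-1 / \<tau>) = theta3 (-1 / (4 * \<tau>)) - theta3 (-1 / \<tau>)" by (simp only: theta2_def)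
  also have "\<dots> = csqrt (4 * (- \<i> * \<tau>)) * theta3 (4 * \<tau>) - csqrt (- \<i> * \<tau>) * theta3 \<tau>"
    using theta3_inversion[of "4 * \<tau>"] theta3_inversion[of \<tau>] assms by (simp add: mult_ac)
  also have "\<dots> = csqrt (- \<i> * \<tau>) * (2 * theta3 (4 * \<tau>) - theta3 \<tau>)"
    by (simp only: csqrt_4_mult) (simp add: algebra_simps)
  also have "2 * theta3 (4 * \<tau>) - theta3 \<tau> = theta4 \<tau>"
    using theta3_add_1[OF assms] by (simp add: theta4_def algebra_simps)
  finally show ?thesis .
qed

lemma theta4_inversion:
  assumes "Im \<tau> > 0"
  shows "theta4 (-1 / \<tau>) = csqrt (- \<i> * \<tau>) * theta2 \<tau>"
proof -
  have "\<tau> \<noteq> 0" using assms by auto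
  have "theta4 (-1 / \<tau>) = 2 * theta3 (4 * (-1 / \<tau>)) - theta3 (-1 / \<tau>)"
    using theta3_add_1[OF Im_neg_inverse_pos[OF assms]] by (simp add: theta4_def algebra_simps)
  also have "4 * (-1 / \<tau>) = -1 / (\<tau> / 4)" by simp
  also have "theta3 (-1 / (\<tau> / 4)) = csqrt (- \<i> * (\<tau> / 4)) * theta3 (\<tau> / 4)"
    using assms by (intro theta3_inversion) simp
  also have "2 * (csqrt (- \<i> * (\<tau> / 4)) * theta3 (\<tau> / 4)) = csqrt (4 * (- \<i> * (\<tau> / 4))) * theta3 (\<tau> / 4)"
    by (simp only: csqrt_4_mult mult.assoc)
  also have "4 * (- \<i> * (\<tau> / 4)) = - \<i> * \<tau>" by simp
  also have "theta3 (-1 / \<tau>) = csqrt (- \<i> * \<tau>) * theta3 \<tau>" by (rule theta3_inversion[OF assms])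
  finally show ?thesis by (simp add: theta2_def algebra_simps)
qed

lemma csqrt_power_8: "csqrt (- \<i> * \<tau>) ^ 8 = \<tau> ^ 4"
proof -
  have "csqrt (- \<i> * \<tau>) ^ 8 = ((csqrt (- \<i> * \<tau>))\<^sup>2) ^ 4" unfolding power_mult [symmetric] by simp
  also have "\<dots> = \<tau> ^ 4" by (simp only: power2_csqrt) (simp add: power_mult_distrib)
  finally show ?thesis .
qed

definition theta_powers :: "(complex \<Rightarrow> complex) set" where
  "theta_powers = {\<lambda>\<tau>. theta2 \<tau> ^ 8, \<lambda>\<tau>. theta3 \<tau> ^ 8, \<lambda>\<tau>. theta4 \<tau> ^ 8}"

lemma theta_powers_T:
  assumes "f \<in> theta_powers"
  shows "\<exists>g\<in>theta_powers. \<forall>\<tau>. Im \<tau> > 0 \<longrightarrow> f (\<tau> + 1) = g \<tau>"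
proof -
  have "theta4 (\<tau> + 1) = theta3 \<tau>" for \<tau> using theta3_add_2[of \<tau>] by (simp add: theta4_def add.commute)
  then show ?thesis using assms theta2_add_1 by (auto simp: theta_powers_def theta4_def)
qed

text \<open>Lets matrices be translated by negative as well as positive integers in
  \<open>hecke_left_T_power\<close>.\<close>

lemma theta_powers_T_inv:
  assumes "f \<in> theta_powers"
  shows "\<exists>g\<in>theta_powers. \<forall>\<tau>. Im \<tau> > 0 \<longrightarrow> f (\<tau> - 1) = g \<tau>"
proof -
  have "theta3 (\<tau> - 1) = theta4 \<tau>" for \<tau> using theta3_add_2[of "\<tau> - 1"] by (simp add: theta4_def add.commute)
  moreover have "theta4 (\<tau> - 1) = theta3 \<tau>" for \<tau> by (simp add: theta4_def)
  moreover have "theta2 (\<tau> - 1) ^ 8 = theta2 \<tau> ^ 8" if "Im \<tau> > 0" for \<tau>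
    using theta2_add_1[of "\<tau> - 1"] that by simp
  ultimately show ?thesis using assms by (auto simp: theta_powers_def)
qed

lemma theta_powers_S:
  assumes "f \<in> theta_powers"
  shows "\<exists>g\<in>theta_powers. \<forall>\<tau>. Im \<tau> > 0 \<longrightarrow> f (-1 / \<tau>) = \<tau> ^ 4 * g \<tau>"
proof -
  have *: "theta2 (-1 / \<tau>) ^ 8 = \<tau> ^ 4 * theta4 \<tau> ^ 8" "theta3 (-1 / \<tau>) ^ 8 = \<tau> ^ 4 * theta3 \<tau> ^ 8"
    "theta4 (-1 / \<tau>) ^ 8 = \<tau> ^ 4 * theta2 \<tau> ^ 8" if "Im \<tau> > 0" for \<tau>
    using that by (simp_all only: theta2_inversion theta3_inversion theta4_inversion power_mult_distrib csqrt_power_8)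
  consider "f = (\<lambda>\<tau>. theta2 \<tau> ^ 8)" | "f = (\<lambda>\<tau>. theta3 \<tau> ^ 8)" | "f = (\<lambda>\<tau>. theta4 \<tau> ^ 8)"
    using assms by (auto simp: theta_powers_def)
  then show ?thesis
  proof cases
    case 1
    show ?thesis unfolding 1 by (rule bexI[of _ "\<lambda>\<tau>. theta4 \<tau> ^ 8"]) (use *(1) in \<open>simp_all add: theta_powers_def\<close>)
  next
    case 2
    show ?thesis unfolding 2 by (rule bexI[of _ "\<lambda>\<tau>. theta3 \<tau> ^ 8"]) (use *(2) in \<open>simp_all add: theta_powers_def\<close>)
  next
    case 3
    show ?thesis unfolding 3 by (rule bexI[of _ "\<lambda>\<tau>. theta2 \<tau> ^ 8"]) (use *(3) in \<open>simp_all add: theta_powers_def\<close>)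
  qed
qed

lemma holomorphic_theta_powers:
  assumes "f \<in> theta_powers"
  shows "f holomorphic_on upper_half_plane"
proof -
  have "(\<lambda>\<tau>. theta3 (\<tau> + 1)) holomorphic_on upper_half_plane"
    by (rule holomorphic_on_compose_gen[unfolded o_def, OF _ holomorphic_theta3])
       (auto intro!: holomorphic_intros)
  moreover have "(\<lambda>\<tau>. theta3 (\<tau> / 4)) holomorphic_on upper_half_plane"
    by (rule holomorphic_on_compose_gen[unfolded o_def, OF _ holomorphic_theta3])
       (auto intro!: holomorphic_intros)
  ultimately show ?thesis
    using assms holomorphic_theta3
    by (auto simp: theta_powers_def theta2_def theta4_def intro!: holomorphic_intros)
qed

lemma bounded_theta_powers:
  assumes "f \<in> theta_powers" "y > 0"
  shows "\<exists>B. \<forall>\<tau>. Im \<tau> \<ge> y \<longrightarrow> norm (f \<tau>) \<le> B"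
proof -
  obtain B where B: "\<And>\<tau>. Im \<tau> \<ge> y / 4 \<Longrightarrow> norm (theta3 \<tau>) \<le> B"
    using bounded_theta3[of "y / 4"] assms by auto
  define C where "C = 2 * B"
  have "norm (theta2 \<tau>) \<le> C \<and> norm (theta3 \<tau>) \<le> C \<and> norm (theta4 \<tau>) \<le> C" if "Im \<tau> \<ge> y" for \<tau>
  proof -
    have "norm (theta3 (\<tau> / 4)) \<le> B" "norm (theta3 \<tau>) \<le> B" "norm (theta3 (\<tau> + 1)) \<le> B"
      using that assms by (intro B; simp)+
    then show ?thesis
      using norm_triangle_ineq4[of "theta3 (\<tau> / 4)" "theta3 \<tau>"] norm_ge_zero[of "theta3 \<tau>"]
      unfolding theta2_def theta4_def C_def by linarith
  qed
  then have "\<forall>\<tau>. Im \<tau> \<ge> y \<longrightarrow> norm (f \<tau>) \<le> (C) ^ 8"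
    using assms by (auto simp: theta_powers_def norm_power intro!: power_mono)
  then show ?thesis by blast
qed

section \<open>Transforms under integer matrices\<close>

text \<open>The weight 4 slash action of the matrix with rows (p, q) and (r, s), without a
  determinant factor. The value 0 off the half plane turns equality there into equality of
  functions.\<close>

definition hecke :: "(complex \<Rightarrow> complex) \<Rightarrow> int \<Rightarrow> int \<Rightarrow> int \<Rightarrow> int \<Rightarrow> complex \<Rightarrow> complex" where
  "hecke f p q r s \<tau> = (if Im \<tau> > 0 then
     f ((of_int p * \<tau> + of_int q) / (of_int r * \<tau> + of_int s)) / (of_int r * \<tau> + of_int s) ^ 4 else 0)"

text \<open>Admitting all matrices of determinant L makes closure under the slash operators, which
  multiply on the right, immediate. Finiteness is the part to be proved.\<close>

definition hecke_family :: "nat \<Rightarrow> (complex \<Rightarrow> complex) set" where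
  "hecke_family L = {hecke f p q r s | f p q r s. f \<in> theta_powers \<and> p * s - q * r = int L}"

lemma moebius_denom_nonzero:
  assumes "Im \<tau> > 0" "p * s - q * r > (0::int)"
  shows "of_int r * \<tau> + of_int s \<noteq> 0"
proof
  assume 0: "of_int r * \<tau> + of_int s = 0"
  then have "Im (of_int r * \<tau> + of_int s) = 0" by simp
  then have "r = 0" using assms by simp
  moreover from this 0 have "s = 0" by simp
  ultimately show False using assms by simp
qed

lemma Im_moebius_pos:
  assumes "Im \<tau> > 0" "p * s - q * r > (0::int)"
  shows "Im ((of_int p * \<tau> + of_int q) / (of_int r * \<tau> + of_int s)) > 0"
proof -
  have nz: "of_int r * \<tau> + of_int s \<noteq> 0" by (rule moebius_denom_nonzero[OF assms])
  have "Im ((of_int p * \<tau> + of_int q) / (of_int r * \<tau> + of_int s)) =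
      of_int (p * s - q * r) * Im \<tau> / (norm (of_int r * \<tau> + of_int s))\<^sup>2"
    by (simp add: Im_divide cmod_power2 algebra_simps)
  moreover have "real_of_int (p * s - q * r) > 0" using assms(2) by (simp only: of_int_0_less_iff)
  ultimately show ?thesis using nz assms(1) by (simp only:) (intro divide_pos_pos mult_pos_pos, auto)
qed

lemma slash_S_hecke:
  "slash_S 4 (hecke f p q r s) = hecke f q (- p) s (- r)"
proof
  fix \<tau>
  show "slash_S 4 (hecke f p q r s) \<tau> = hecke f q (- p) s (- r) \<tau>"
  proof (cases "Im \<tau> > 0")
    case True
    then have nz: "\<tau> \<noteq> 0" by auto
    have 1: "of_int r * (-1 / \<tau>) + of_int s = (of_int s * \<tau> + of_int (- r)) / \<tau>"
      and 2: "of_int p * (-1 / \<tau>) + of_int q = (of_int q * \<tau> + of_int (- p)) / \<tau>"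
      using nz by (simp_all add: field_simps)
    have "hecke f p q r s (-1 / \<tau>) =
        f ((of_int q * \<tau> + of_int (- p)) / \<tau> / ((of_int s * \<tau> + of_int (- r)) / \<tau>)) /
          ((of_int s * \<tau> + of_int (- r)) / \<tau>) ^ 4"
      using Im_neg_inverse_pos[OF True] by (simp only: hecke_def 1 2 if_True)
    also have "\<dots> = f ((of_int q * \<tau> + of_int (- p)) / (of_int s * \<tau> + of_int (- r))) /
          (of_int s * \<tau> + of_int (- r)) ^ 4 * \<tau> ^ 4"
      using nz by (simp add: power_divide)
    finally show ?thesis using True nz by (simp add: slash_S_def hecke_def)
  qed (simp add: slash_S_def hecke_def)
qed

lemma slash_T_hecke:
  "slash_T (hecke f p q r s) = hecke f p (q + p) r (s + r)"
  by (rule ext) (simp add: slash_T_def hecke_def algebra_simps)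

lemma slash_hecke_family:
  assumes "f \<in> hecke_family L"
  shows "slash_S 4 f \<in> hecke_family L" "slash_T f \<in> hecke_family L"
proof -
  obtain g p q r s where g: "f = hecke g p q r s" "g \<in> theta_powers" "p * s - q * r = int L"
    using assms by (auto simp: hecke_family_def)
  have "q * (- r) - (- p) * s = int L" "p * (s + r) - (q + p) * r = int L"
    using g(3) by (simp_all add: algebra_simps)
  then show "slash_S 4 f \<in> hecke_family L" "slash_T f \<in> hecke_family L"
    unfolding g(1) slash_S_hecke slash_T_hecke hecke_family_def using g(2) by blast+
qed

text \<open>Adding the lower row to the upper one keeps the denominator and shifts the argument by
  1, which only exchanges one theta power for another.\<close>

lemma hecke_left_T:
  assumes "f \<in> theta_powers" "p * s - q * r > 0"
  shows "\<exists>g\<in>theta_powers. hecke f (p + r) (q + s) r s = hecke g p q r s"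
    and "\<exists>g\<in>theta_powers. hecke f (p - r) (q - s) r s = hecke g p q r s"
proof -
  obtain g where g: "g \<in> theta_powers" "\<And>\<tau>. Im \<tau> > 0 \<Longrightarrow> f (\<tau> + 1) = g \<tau>"
    using theta_powers_T[OF assms(1)] by blast
  have "hecke f (p + r) (q + s) r s \<tau> = hecke g p q r s \<tau>" for \<tau>
  proof (cases "Im \<tau> > 0")
    case True
    have "(of_int (p + r) * \<tau> + of_int (q + s)) / (of_int r * \<tau> + of_int s) =
        (of_int p * \<tau> + of_int q) / (of_int r * \<tau> + of_int s) + 1"
      using moebius_denom_nonzero[OF True assms(2)] by (simp add: field_simps)
    then show ?thesis
      using g(2)[OF Im_moebius_pos[OF True assms(2)]] by (simp only: hecke_def)
  qed (simp add: hecke_def)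
  then show "\<exists>g\<in>theta_powers. hecke f (p + r) (q + s) r s = hecke g p q r s" using g(1) by blast
  obtain g where g: "g \<in> theta_powers" "\<And>\<tau>. Im \<tau> > 0 \<Longrightarrow> f (\<tau> - 1) = g \<tau>"
    using theta_powers_T_inv[OF assms(1)] by blast
  have "hecke f (p - r) (q - s) r s \<tau> = hecke g p q r s \<tau>" for \<tau>
  proof (cases "Im \<tau> > 0")
    case True
    have "(of_int (p - r) * \<tau> + of_int (q - s)) / (of_int r * \<tau> + of_int s) =
        (of_int p * \<tau> + of_int q) / (of_int r * \<tau> + of_int s) - 1"
      using moebius_denom_nonzero[OF True assms(2)] by (simp add: field_simps)
    then show ?thesis
      using g(2)[OF Im_moebius_pos[OF True assms(2)]] by (simp only: hecke_def)
  qed (simp add: hecke_def)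
  then show "\<exists>g\<in>theta_powers. hecke f (p - r) (q - s) r s = hecke g p q r s" using g(1) by blast
qed

lemma hecke_left_T_power:
  assumes "f \<in> theta_powers" "p * s - q * r > 0"
  shows "\<exists>g\<in>theta_powers. hecke f p q r s = hecke g (p + k * r) (q + k * s) r s"
proof (induction k rule: int_induct[of _ 0])
  case base
  then show ?case using assms by auto
next
  case (step1 k)
  then obtain g where g: "g \<in> theta_powers" "hecke f p q r s = hecke g (p + k * r) (q + k * s) r s"
    by blast
  have "(p + (k + 1) * r) * s - (q + (k + 1) * s) * r > 0" using assms(2) by (simp add: algebra_simps)
  \<comment> \<open>Increasing \<open>k\<close> uses the subtraction rule: removing the lower row
    from the matrix for k + 1 gives that for k.\<close>
  from hecke_left_T(2)[OF g(1) this] show ?case using g(2) by (simp add: algebra_simps)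
next
  case (step2 k)
  then obtain g where g: "g \<in> theta_powers" "hecke f p q r s = hecke g (p + k * r) (q + k * s) r s"
    by blast
  have "(p + (k - 1) * r) * s - (q + (k - 1) * s) * r > 0" using assms(2) by (simp add: algebra_simps)
  from hecke_left_T(1)[OF g(1) this] show ?case using g(2) by (simp add: algebra_simps)
qed

text \<open>The weight matches: the factor \<open>(D / N) ^ 4\<close> from inversion turns the
  denominator \<open>D ^ 4\<close> into \<open>N ^ 4\<close>, the one belonging to the new
  matrix.\<close>

lemma hecke_left_S:
  assumes "f \<in> theta_powers" "p * s - q * r > 0"
  shows "\<exists>g\<in>theta_powers. hecke f p q r s = hecke g r s (- p) (- q)"
proof -
  obtain g where g: "g \<in> theta_powers" "\<And>\<tau>. Im \<tau> > 0 \<Longrightarrow> f (-1 / \<tau>) = \<tau> ^ 4 * g \<tau>"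
    using theta_powers_S[OF assms(1)] by blast
  have det: "r * (- q) - s * (- p) > 0" using assms(2) by (simp add: algebra_simps)
  have "hecke f p q r s \<tau> = hecke g r s (- p) (- q) \<tau>" for \<tau>
  proof (cases "Im \<tau> > 0")
    case True
    define N where "N = of_int (- p) * \<tau> + of_int (- q)"
    define D where "D = of_int r * \<tau> + of_int s"
    have N0: "N \<noteq> 0" unfolding N_def by (rule moebius_denom_nonzero[OF True det])
    have D0: "D \<noteq> 0" unfolding D_def by (rule moebius_denom_nonzero[OF True assms(2)])
    have "of_int p * \<tau> + of_int q = - N" by (simp add: N_def)
    moreover have "- N / D = -1 / (D / N)" using N0 D0 by simp
    ultimately have "hecke f p q r s \<tau> = f (-1 / (D / N)) / D ^ 4"
      using True by (simp only: hecke_def D_def if_True)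
    also have "f (-1 / (D / N)) = (D / N) ^ 4 * g (D / N)"
      using Im_moebius_pos[OF True det] by (intro g(2)) (simp add: D_def N_def)
    finally show ?thesis
      using True D0 by (simp add: hecke_def D_def [symmetric] N_def power_divide)
  qed (simp add: hecke_def)
  then show ?thesis using g(1) by blast
qed

text \<open>Euclid's algorithm on the first column, through the left action.\<close>

lemma hecke_upper_triangular:
  assumes "f \<in> theta_powers" "p * s - q * r = int L" "L \<ge> 1"
  shows "\<exists>g\<in>theta_powers. \<exists>a b d. a * d = int L \<and> hecke f p q r s = hecke g a b 0 d"
  using assms(1,2)
proof (induction "nat \<bar>r\<bar>" arbitrary: f p q r s rule: less_induct)
  case less
  show ?case
  proof (cases "r = 0")
    case True
    then show ?thesis using less.prems by auto
  next
    case False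
    \<comment> \<open>Translation reduces \<open>p\<close> to \<open>p mod r\<close>; inversion then
      moves it, negated, to the lower left corner.\<close>
    define k where "k = - (p div r)"
    define p' where "p' = p + k * r"
    define q' where "q' = q + k * s"
    have p': "p' = p mod r" by (simp add: p'_def k_def minus_div_mult_eq_mod)
    obtain g where g: "g \<in> theta_powers" "hecke f p q r s = hecke g p' q' r s"
      using hecke_left_T_power[OF less.prems(1), of p s q r k] less.prems(2) assms(3)
      unfolding p'_def q'_def by auto
    have det: "p' * s - q' * r = int L"
      using less.prems(2) by (simp add: p'_def q'_def algebra_simps)
    obtain g' where g': "g' \<in> theta_powers" "hecke g p' q' r s = hecke g' r s (- p') (- q')"
      using hecke_left_S[OF g(1), of p' s q' r] det assms(3) by auto
    have "\<bar>p mod r\<bar> < \<bar>r\<bar>" using False by (rule abs_mod_less)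
    then have "nat \<bar>- p'\<bar> < nat \<bar>r\<bar>" by (simp add: p')
    then show ?thesis
      using less.hyps[of "- p'" g' r "- q'" s] g' g(2) det by (simp add: algebra_simps)
  qed
qed

text \<open>From a triangular matrix one reaches d > 0 by a sign change and 0 \<le> b < d by
  translation; a d = L bounds the rest. A finite box suffices, so the representatives need not be
  unique.\<close>

lemma hecke_family_reduced:
  assumes "f \<in> hecke_family L" "L \<ge> 1"
  shows "\<exists>g\<in>theta_powers. \<exists>a\<in>{1..int L}. \<exists>b\<in>{0..int L}. \<exists>d\<in>{1..int L}. f = hecke g a b 0 d"
proof -
  obtain f' p q r s where f': "f = hecke f' p q r s" "f' \<in> theta_powers" "p * s - q * r = int L"
    using assms by (auto simp: hecke_family_def)
  obtain g a b d where g: "g \<in> theta_powers" "a * d = int L" "f = hecke g a b 0 d"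
    using hecke_upper_triangular[OF f'(2,3) assms(2)] f'(1) by blast
  obtain a b d where d: "a * d = int L" "f = hecke g a b 0 d" "d > 0"
  proof (cases "d > 0")
    case False
    \<comment> \<open>Minus the identity acts trivially because the weight is even.\<close>
    have "hecke g a b 0 d = hecke g (- a) (- b) 0 (- d)"
    proof
      fix \<tau> :: complex
      have "(of_int (- a) * \<tau> + of_int (- b)) / of_int (- d) = (- (of_int a * \<tau> + of_int b)) / (- of_int d)"
        by simp
      also have "\<dots> = (of_int a * \<tau> + of_int b) / of_int d" by (rule minus_divide_divide)
      finally show "hecke g a b 0 d \<tau> = hecke g (- a) (- b) 0 (- d) \<tau>"
        by (simp add: hecke_def)
    qed
    moreover have "d \<noteq> 0" using g(2) assms(2) by auto
    ultimately show ?thesis using that[of "- a" "- d" "- b"] g False by auto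
  qed (use g that in auto)
  have "a > 0" using d(1,3) assms(2) by (metis of_nat_0_less_iff less_le_trans zero_less_one zero_less_mult_pos2)
  obtain h where h: "h \<in> theta_powers" "f = hecke h a (b mod d) 0 d"
    using hecke_left_T_power[OF g(1), of a d b 0 "- (b div d)"] d assms(2)
    by (auto simp: minus_div_mult_eq_mod)
  have dL: "d \<le> int L" using mult_right_mono[of 1 a d] d \<open>a > 0\<close> by simp
  have aL: "a \<le> int L" using mult_left_mono[of 1 d a] d \<open>a > 0\<close> by simp
  have "b mod d \<in> {0..int L}"
    using pos_mod_sign[OF d(3), of b] pos_mod_bound[OF d(3), of b] dL by auto
  then show ?thesis using h \<open>a > 0\<close> d(3) dL aL by (metis atLeastAtMost_iff int_one_le_iff_zero_less)
qed

lemma finite_hecke_family: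
  assumes "L \<ge> 1"
  shows "finite (hecke_family L)"
proof (rule finite_subset)
  show "hecke_family L \<subseteq> (\<lambda>(g, a, b, d). hecke g a b 0 d) `
      (theta_powers \<times> {1..int L} \<times> {0..int L} \<times> {1..int L})"
  proof
    fix f assume "f \<in> hecke_family L"
    from hecke_family_reduced[OF this assms]
    show "f \<in> (\<lambda>(g, a, b, d). hecke g a b 0 d) ` (theta_powers \<times> {1..int L} \<times> {0..int L} \<times> {1..int L})"
      by force
  qed
qed (auto simp: theta_powers_def)

text \<open>Read off from the triangular representative, whose action is affine: the argument keeps
  its distance from the real axis, so f is bounded near infinity.\<close>

lemma hecke_family_properties:
  assumes "f \<in> hecke_family L" "L \<ge> 1"
  shows "f holomorphic_on upper_half_plane"
    and "\<exists>B. \<forall>\<tau>. Im \<tau> \<ge> 1/4 \<longrightarrow> norm (f \<tau>) \<le> B"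
    and "\<And>\<tau>. Im \<tau> \<le> 0 \<Longrightarrow> f \<tau> = 0"
proof -
  obtain g a b d where g: "g \<in> theta_powers" "f = hecke g a b 0 d"
    and ad: "1 \<le> a" "1 \<le> d" "d \<le> int L"
    using hecke_family_reduced[OF assms] by auto
  define \<phi> where "\<phi> \<tau> = (of_int a * \<tau> + of_int b) / of_int d" for \<tau> :: complex
  have f: "f \<tau> = (if Im \<tau> > 0 then g (\<phi> \<tau>) / of_int d ^ 4 else 0)" for \<tau>
    by (simp add: g(2) hecke_def \<phi>_def)
  have Im_\<phi>: "Im (\<phi> \<tau>) = of_int a * Im \<tau> / of_int d" for \<tau>
    using Im_divide_of_real[of "of_int a * \<tau> + of_int b" "real_of_int d"] by (simp add: \<phi>_def)
  show "Im \<tau> \<le> 0 \<Longrightarrow> f \<tau> = 0" for \<tau> by (simp add: f)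
  have "(\<lambda>\<tau>. g (\<phi> \<tau>)) holomorphic_on upper_half_plane"
  proof (rule holomorphic_on_compose_gen[of \<phi> _ g upper_half_plane, unfolded o_def])
    show "\<phi> holomorphic_on upper_half_plane"
      unfolding \<phi>_def using ad by (intro holomorphic_intros) auto
    show "\<phi> ` upper_half_plane \<subseteq> upper_half_plane" using ad by (auto simp: Im_\<phi>)
  qed (rule holomorphic_theta_powers[OF g(1)])
  then have "(\<lambda>\<tau>. g (\<phi> \<tau>) / of_int d ^ 4) holomorphic_on upper_half_plane"
    using ad by (intro holomorphic_intros) auto
  then show "f holomorphic_on upper_half_plane"
    by (rule holomorphic_transform) (simp add: f)
  \<comment> \<open>The least possible height of a \<tau> / d, given a \<ge> 1, d \<le> L and Im
    \<tau> \<ge> 1/4.\<close>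
  define y where "y = 1 / (4 * real L)"
  have "y > 0" using assms(2) by (simp add: y_def)
  then obtain B where B: "\<And>\<tau>. Im \<tau> \<ge> y \<Longrightarrow> norm (g \<tau>) \<le> B"
    using bounded_theta_powers[OF g(1)] by blast
  have "norm (f \<tau>) \<le> B" if \<tau>: "Im \<tau> \<ge> 1/4" for \<tau>
  proof -
    have "y = (1 * (1/4)) / real L" by (simp add: y_def)
    also have "\<dots> \<le> of_int a * Im \<tau> / of_int d"
      using ad \<tau> by (intro frac_le mult_mono) auto
    finally have gB: "norm (g (\<phi> \<tau>)) \<le> B" by (intro B) (simp add: Im_\<phi>)
    have "(1::real) \<le> of_int d ^ 4" using ad by (intro one_le_power) auto
    then have "norm (g (\<phi> \<tau>)) / of_int d ^ 4 \<le> norm (g (\<phi> \<tau>)) / 1"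
      by (intro divide_left_mono) auto
    then show ?thesis using gB \<tau> ad by (simp add: f norm_divide norm_power)
  qed
  then show "\<exists>B. \<forall>\<tau>. Im \<tau> \<ge> 1/4 \<longrightarrow> norm (f \<tau>) \<le> B" by blast
qed

definition theta3_power :: "nat \<Rightarrow> complex \<Rightarrow> complex" where
  "theta3_power L \<tau> = (if Im \<tau> > 0 then theta3 (of_nat L * \<tau>) ^ 8 else 0)"

lemma theta3_power_in_hecke_family: "theta3_power L \<in> hecke_family L"
proof -
  have "theta3_power L = hecke (\<lambda>\<tau>. theta3 \<tau> ^ 8) (int L) 0 0 1"
    by (rule ext) (simp add: theta3_power_def hecke_def)
  moreover have "(\<lambda>\<tau>. theta3 \<tau> ^ 8) \<in> theta_powers" by (simp add: theta_powers_def)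
  moreover have "int L * 1 - 0 * 0 = int L" by simp
  ultimately show ?thesis unfolding hecke_family_def by blast
qed

section \<open>Algebraic dependence\<close>

text \<open>Gaussian elimination, one equation at a time. Working over an arbitrary field allows
  solutions over \<open>rat\<close>.\<close>

lemma homogeneous_linear_system_nontrivial_solution:
  fixes M :: "nat \<Rightarrow> 'b \<Rightarrow> 'a::field"
  assumes "finite J" "card J > t"
  shows "\<exists>a. (\<exists>j\<in>J. a j \<noteq> 0) \<and> (\<forall>i<t. (\<Sum>j\<in>J. a j * M i j) = 0)"
  using assms
proof (induction t arbitrary: J M)
  case 0
  then have "J \<noteq> {}" by auto
  then show ?case by (intro exI[of _ "\<lambda>_. 1"]) auto
next
  case (Suc t)
  show ?case
  proof (cases "\<forall>j\<in>J. M t j = 0")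
    case True
    obtain a where a: "\<exists>j\<in>J. a j \<noteq> 0" "\<forall>i<t. (\<Sum>j\<in>J. a j * M i j) = 0"
      using Suc.IH[of J M] Suc.prems by auto
    then have "\<forall>i<Suc t. (\<Sum>j\<in>J. a j * M i j) = 0" using True by (auto simp: less_Suc_eq)
    then show ?thesis using a by blast
  next
    case False
    then obtain k where k: "k \<in> J" "M t k \<noteq> 0" by blast
    define M' where "M' i j = M i j - M i k * M t j / M t k" for i j
    have card: "card (J - {k}) > t" using Suc.prems k by simp
    obtain a where a: "\<exists>j\<in>J - {k}. a j \<noteq> 0" "\<forall>i<t. (\<Sum>j\<in>J - {k}. a j * M' i j) = 0"
      using Suc.IH[OF _ card, of M'] Suc.prems by auto
    \<comment> \<open>The pivot unknown is the one value that satisfies row \<open>t\<close>;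
      inserting it turns the other rows into those of \<open>M'\<close>.\<close>
    define b where "b = a(k := - (\<Sum>j\<in>J - {k}. a j * M t j) / M t k)"
    have sum_b: "(\<Sum>j\<in>J. b j * M i j) = (\<Sum>j\<in>J - {k}. a j * M' i j)" for i
    proof -
      have "(\<Sum>j\<in>J. b j * M i j) = b k * M i k + (\<Sum>j\<in>J - {k}. b j * M i j)"
        using Suc.prems k by (intro sum.remove) auto
      also have "(\<Sum>j\<in>J - {k}. b j * M i j) = (\<Sum>j\<in>J - {k}. a j * M i j)"
        by (intro sum.cong) (auto simp: b_def)
      also have "b k * M i k = - (\<Sum>j\<in>J - {k}. a j * (M i k * M t j / M t k))"
        by (simp add: b_def sum_distrib_left sum_distrib_right sum_divide_distrib mult_ac)
      finally show ?thesis
        by (simp add: M'_def right_diff_distrib sum_subtractf)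
    qed
    have "(\<Sum>j\<in>J. b j * M t j) = 0"
      unfolding sum_b using k by (simp add: M'_def)
    then have "\<forall>i<Suc t. (\<Sum>j\<in>J. b j * M i j) = 0" using a by (auto simp: less_Suc_eq sum_b)
    moreover have "\<exists>j\<in>J. b j \<noteq> 0" using a by (auto simp: b_def)
    ultimately show ?thesis by blast
  qed
qed

lemma map_poly_add_hom:
  assumes "f 0 = 0" "\<And>a b. f (a + b) = f a + f b"
  shows "map_poly f (p + q) = map_poly f p + map_poly f q"
  by (rule poly_eqI) (simp add: coeff_map_poly assms)

lemma eval3_add: "eval3 (P + Q) x y z = eval3 P x y z + eval3 Q x y z"
proof -
  have 1: "poly (map_poly of_rat (R + R')) z = poly (map_poly of_rat R) z + poly (map_poly of_rat R') z" for R R'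
    by (subst map_poly_add_hom) (auto simp: of_rat_add)
  have 2: "poly (map_poly (\<lambda>R. poly (map_poly of_rat R) z) (A + B)) y =
      poly (map_poly (\<lambda>R. poly (map_poly of_rat R) z) A) y + poly (map_poly (\<lambda>R. poly (map_poly of_rat R) z) B) y" for A B
    by (subst map_poly_add_hom) (auto simp: 1)
  show ?thesis unfolding eval3_def by (subst map_poly_add_hom) (auto simp: 2)
qed

lemma eval3_sum: "eval3 (\<Sum>i\<in>I. P i) x y z = (\<Sum>i\<in>I. eval3 (P i) x y z)"
proof (induction I rule: infinite_finite_induct)
  case (insert i I)
  then show ?case by (simp add: eval3_add)
qed (simp_all add: eval3_def)

lemma eval3_monom:
  "eval3 (monom (monom (monom c k) j) i) x y z = of_rat c * x ^ i * y ^ j * z ^ k"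
  by (simp add: eval3_def map_poly_monom poly_monom mult_ac)

text \<open>Distinct exponent triples prevent cancellation, so the coefficient belonging to
  \<open>i0\<close> survives in the polynomial.\<close>

lemma alg_dependent3I:
  fixes a :: "'i \<Rightarrow> rat"
  assumes "finite I" "inj_on (\<lambda>i. (\<alpha> i, \<beta> i, \<gamma> i)) I" "i0 \<in> I" "a i0 \<noteq> 0"
    and "(\<Sum>i\<in>I. of_rat (a i) * x ^ \<alpha> i * y ^ \<beta> i * z ^ \<gamma> i) = 0"
  shows "alg_dependent3 x y z"
proof -
  define P where "P = (\<Sum>i\<in>I. monom (monom (monom (a i) (\<gamma> i)) (\<beta> i)) (\<alpha> i))"
  have "coeff (coeff (coeff P (\<alpha> i0)) (\<beta> i0)) (\<gamma> i0) = (\<Sum>i\<in>I. if i = i0 then a i else 0)"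
    unfolding P_def coeff_sum
  proof (intro sum.cong refl)
    fix i assume "i \<in> I"
    then have "\<alpha> i = \<alpha> i0 \<and> \<beta> i = \<beta> i0 \<and> \<gamma> i = \<gamma> i0 \<longleftrightarrow> i = i0"
      using inj_onD[OF assms(2), of i i0] assms(3) by auto
    then show "coeff (coeff (coeff (monom (monom (monom (a i) (\<gamma> i)) (\<beta> i)) (\<alpha> i)) (\<alpha> i0)) (\<beta> i0)) (\<gamma> i0) =
        (if i = i0 then a i else 0)"
      by auto
  qed
  also have "\<dots> = a i0" using assms(1,3) by simp
  finally have "P \<noteq> 0" using assms(4) by auto
  moreover have "eval3 P x y z = 0"
    unfolding P_def eval3_sum eval3_monom by (rule assms(5))
  ultimately show ?thesis unfolding alg_dependent3_def by blast
qed

lemma fps_nth_mult_Rats: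
  fixes f g :: "'a::field_char_0 fps"
  assumes "\<And>n. fps_nth f n \<in> \<rat>" "\<And>n. fps_nth g n \<in> \<rat>"
  shows "fps_nth (f * g) n \<in> \<rat>"
  unfolding fps_mult_nth by (intro Rats_sum Rats_mult assms)

lemma fps_nth_power_Rats:
  fixes f :: "'a::field_char_0 fps"
  assumes "\<And>n. fps_nth f n \<in> \<rat>"
  shows "fps_nth (f ^ k) n \<in> \<rat>"
proof (induction k arbitrary: n)
  case (Suc k)
  then show ?case unfolding power_Suc by (intro fps_nth_mult_Rats assms)
qed simp

lemma eval_fps_sum:
  fixes f :: "'i \<Rightarrow> complex fps"
  assumes "\<And>i. i \<in> I \<Longrightarrow> ereal (norm z) < fps_conv_radius (f i)"
  shows "ereal (norm z) < fps_conv_radius (\<Sum>i\<in>I. f i) \<and> eval_fps (\<Sum>i\<in>I. f i) z = (\<Sum>i\<in>I. eval_fps (f i) z)"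
  using assms
proof (induction I rule: infinite_finite_induct)
  case (insert i I)
  then have "ereal (norm z) < min (fps_conv_radius (f i)) (fps_conv_radius (\<Sum>i\<in>I. f i))" by simp
  then have "ereal (norm z) < fps_conv_radius (f i + (\<Sum>i\<in>I. f i))"
    using fps_conv_radius_add less_le_trans by blast
  then show ?case using insert by (simp add: eval_fps_add)
qed simp_all

text \<open>Dividing by the t-th power of the variable leaves a series with the same radius, bounded
  on the compact disc.\<close>

lemma eval_fps_vanishing_bound:
  fixes Q :: "complex fps"
  assumes rad: "fps_conv_radius Q \<ge> 1" and "r < 1" and van: "\<And>k. k < t \<Longrightarrow> fps_nth Q k = 0"
  shows "\<exists>C. \<forall>w. norm w \<le> r \<longrightarrow> norm (eval_fps Q w) \<le> C * norm w ^ t"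
proof -
  define S where "S = fps_shift t Q"
  have Q: "Q = S * fps_X ^ t"
  proof (rule fps_ext)
    fix k
    show "fps_nth Q k = fps_nth (S * fps_X ^ t) k"
      using van[of k] by (auto simp: S_def fps_X_power_mult_right_nth)
  qed
  have radS: "ereal (norm w) < fps_conv_radius S" if "norm w \<le> r" for w :: complex
  proof -
    have "ereal (norm w) < 1" using that \<open>r < 1\<close> by simp
    also note rad
    finally show ?thesis by (simp add: S_def)
  qed
  then have "cball (0::complex) r \<subseteq> eball 0 (fps_conv_radius S)" by auto
  then have "eval_fps S holomorphic_on cball 0 r" by (rule holomorphic_on_eval_fps)
  then have "bounded (eval_fps S ` cball 0 r)"
    by (intro compact_imp_bounded compact_continuous_image holomorphic_on_imp_continuous_on) auto
  then obtain C where C: "\<And>w. w \<in> cball 0 r \<Longrightarrow> norm (eval_fps S w) \<le> C"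
    unfolding bounded_iff by blast
  have "norm (eval_fps Q w) \<le> C * norm w ^ t" if "norm w \<le> r" for w
  proof -
    have "eval_fps Q w = eval_fps S w * w ^ t"
      unfolding Q using radS[OF that] by (subst eval_fps_mult) simp_all
    then show ?thesis using C[of w] that by (simp add: norm_mult norm_power mult_right_mono)
  qed
  then show ?thesis by blast
qed

section \<open>Homogeneous forms in three variables\<close>

lemma card_triangle: "card {(i, j). i + j \<le> d} = (d + 1) * (d + 2) div 2"
proof -
  have "{(i, j). i + j \<le> d} = (SIGMA i:{..d}. {..d - i})" by auto
  then have "card {(i, j). i + j \<le> d} = (\<Sum>i\<le>d. Suc (d - i))" by simp
  also have "\<dots> = (\<Sum>i\<le>d. Suc i)"
    by (rule sum.reindex_bij_witness[of _ "\<lambda>i. d - i" "\<lambda>i. d - i"]) auto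
  also have "\<dots> = (d + 1) * (d + 2) div 2"
    by (induction d) auto
  finally show ?thesis .
qed

text \<open>Pairs index the monomials, since the degree fixes the third exponent. Homogeneity gives
  all terms the same weight 4d.\<close>

definition homogeneous_form :: "(nat \<times> nat \<Rightarrow> rat) \<Rightarrow> nat \<Rightarrow> complex \<Rightarrow> complex \<Rightarrow> complex \<Rightarrow> complex" where
  "homogeneous_form a d x y z = (\<Sum>(i, j)\<in>{(i, j). i + j \<le> d}. of_rat (a (i, j)) * x ^ i * y ^ j * z ^ (d - i - j))"

lemma homogeneous_form_divide:
  assumes "c \<noteq> 0"
  shows "homogeneous_form a d (x / c) (y / c) (z / c) = homogeneous_form a d x y z / c ^ d"
  unfolding homogeneous_form_def sum_divide_distrib
proof (intro sum.cong refl, safe)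
  fix i j assume "i + j \<le> d"
  then have "c ^ d = c ^ i * c ^ j * c ^ (d - i - j)" by (simp flip: power_add)
  then show "of_rat (a (i, j)) * (x / c) ^ i * (y / c) ^ j * (z / c) ^ (d - i - j) =
      of_rat (a (i, j)) * x ^ i * y ^ j * z ^ (d - i - j) / c ^ d"
    by (simp add: power_divide)
qed

lemma finite_triangle: "finite {(i::nat, j). i + j \<le> d}"
  by (rule finite_subset[of _ "{..d} \<times> {..d}"]) auto

definition form_of :: "(nat \<times> nat \<Rightarrow> rat) \<Rightarrow> nat \<Rightarrow>
    (complex \<Rightarrow> complex) \<times> (complex \<Rightarrow> complex) \<times> (complex \<Rightarrow> complex) \<Rightarrow> complex \<Rightarrow> complex" where
  "form_of a d = (\<lambda>(f, g, h) \<tau>. if Im \<tau> > 0 then homogeneous_form a d (f \<tau>) (g \<tau>) (h \<tau>) else 0)"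

lemma slash_form_of:
  "slash_S (4 * d) (form_of a d (f, g, h)) = form_of a d (slash_S 4 f, slash_S 4 g, slash_S 4 h)"
  "slash_T (form_of a d (f, g, h)) = form_of a d (slash_T f, slash_T g, slash_T h)"
proof -
  show "slash_S (4 * d) (form_of a d (f, g, h)) = form_of a d (slash_S 4 f, slash_S 4 g, slash_S 4 h)"
  proof
    fix \<tau>
    show "slash_S (4 * d) (form_of a d (f, g, h)) \<tau> = form_of a d (slash_S 4 f, slash_S 4 g, slash_S 4 h) \<tau>"
    proof (cases "Im \<tau> > 0")
      case True
      then have "\<tau> ^ 4 \<noteq> 0" by auto
      from homogeneous_form_divide[OF this] show ?thesis
        using True Im_neg_inverse_pos[OF True] by (simp add: slash_S_def form_of_def power_mult)
    qed (simp add: slash_S_def form_of_def)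
  qed
  show "slash_T (form_of a d (f, g, h)) = form_of a d (slash_T f, slash_T g, slash_T h)"
    by (rule ext) (simp add: slash_T_def form_of_def)
qed

lemma holomorphic_form_of:
  assumes "f holomorphic_on upper_half_plane" "g holomorphic_on upper_half_plane"
    "h holomorphic_on upper_half_plane"
  shows "form_of a d (f, g, h) holomorphic_on upper_half_plane"
proof -
  have "(\<lambda>\<tau>. homogeneous_form a d (f \<tau>) (g \<tau>) (h \<tau>)) holomorphic_on upper_half_plane"
    unfolding homogeneous_form_def case_prod_beta by (intro holomorphic_intros assms)
  then show ?thesis by (rule holomorphic_transform) (simp add: form_of_def)
qed

lemma bounded_form_of:
  assumes "\<exists>B. \<forall>\<tau>. Im \<tau> \<ge> 1/4 \<longrightarrow> norm (f \<tau>) \<le> B" "\<exists>B. \<forall>\<tau>. Im \<tau> \<ge> 1/4 \<longrightarrow> norm (g \<tau>) \<le> B"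
    "\<exists>B. \<forall>\<tau>. Im \<tau> \<ge> 1/4 \<longrightarrow> norm (h \<tau>) \<le> B"
  shows "\<exists>B. \<forall>\<tau>. Im \<tau> \<ge> 1/4 \<longrightarrow> norm (form_of a d (f, g, h) \<tau>) \<le> B"
proof -
  obtain A B C where ABC: "\<And>\<tau>. Im \<tau> \<ge> 1/4 \<Longrightarrow> norm (f \<tau>) \<le> A" "\<And>\<tau>. Im \<tau> \<ge> 1/4 \<Longrightarrow> norm (g \<tau>) \<le> B"
    "\<And>\<tau>. Im \<tau> \<ge> 1/4 \<Longrightarrow> norm (h \<tau>) \<le> C"
    using assms by metis
  have "norm (form_of a d (f, g, h) \<tau>) \<le>
      (\<Sum>(i, j)\<in>{(i, j). i + j \<le> d}. norm (of_rat (a (i, j)) :: complex) * A ^ i * B ^ j * C ^ (d - i - j))"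
    if \<tau>: "Im \<tau> \<ge> 1/4" for \<tau>
  proof -
    have "form_of a d (f, g, h) \<tau> = homogeneous_form a d (f \<tau>) (g \<tau>) (h \<tau>)"
      using \<tau> by (simp add: form_of_def)
    also have "norm \<dots> \<le> (\<Sum>(i, j)\<in>{(i, j). i + j \<le> d}. norm (of_rat (a (i, j)) :: complex) * A ^ i * B ^ j * C ^ (d - i - j))"
      unfolding homogeneous_form_def
    proof (intro order_trans[OF norm_sum] sum_mono, safe)
      fix i j assume "i + j \<le> d"
      have nonneg: "0 \<le> A" "0 \<le> B" "0 \<le> C"
        using ABC[OF \<tau>] norm_ge_zero order_trans by blast+
      show "norm (of_rat (a (i, j)) * f \<tau> ^ i * g \<tau> ^ j * h \<tau> ^ (d - i - j)) \<le>
          norm (of_rat (a (i, j)) :: complex) * A ^ i * B ^ j * C ^ (d - i - j)"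
        unfolding norm_mult norm_power using ABC[OF \<tau>] nonneg
        by (intro mult_mono power_mono mult_nonneg_nonneg zero_le_power norm_ge_zero order_refl)
    qed
    finally show ?thesis .
  qed
  then show ?thesis by blast
qed

text \<open>The unknowns are the coefficients of the form, the equations the vanishing of the first
  t coefficients in q; t is smaller than the number of monomials.\<close>

lemma exists_form_vanishing_at_cusp:
  fixes l m n :: nat
  assumes lmn: "l \<ge> 1" "m \<ge> 1" "n \<ge> 1" and t: "t < (d + 1) * (d + 2) div 2"
  shows "\<exists>a. (\<exists>x\<in>{(i, j). i + j \<le> d}. a x \<noteq> 0) \<and>
    (\<exists>C. \<forall>\<tau>. Im \<tau> \<ge> 1/4 \<longrightarrow>
      norm (form_of a d (theta3_power l, theta3_power m, theta3_power n) \<tau>) * exp (pi * real t * Im \<tau>) \<le> C)"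
proof -
  let ?J = "{(i::nat, j). i + j \<le> d}"
  define c where "c = (\<lambda>(i, j). (theta_fps l ^ 8) ^ i * (theta_fps m ^ 8) ^ j * (theta_fps n ^ 8) ^ (d - i - j))"
  have th: "fps_nth (theta_fps L) k \<in> \<rat>" for L k by (simp add: theta_fps_def)
  have rat: "fps_nth (c x) k \<in> \<rat>" for x k
    unfolding c_def case_prod_beta by (intro fps_nth_mult_Rats fps_nth_power_Rats th)
  then have "\<forall>k x. \<exists>q. fps_nth (c x) k = of_rat q" by (metis Rats_cases)
  \<comment> \<open>Rational entries, so that the system is solved over \<open>rat\<close> and not
    merely over the complex numbers.\<close>
  then obtain M where M: "\<And>k x. fps_nth (c x) k = of_rat (M k x)" by metis
  obtain a where a: "\<exists>x\<in>?J. a x \<noteq> 0" "\<forall>k<t. (\<Sum>x\<in>?J. a x * M k x) = 0"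
    using homogeneous_linear_system_nontrivial_solution[OF finite_triangle[of d], of t M] t
    by (auto simp: card_triangle)
  define Q where "Q = (\<Sum>x\<in>?J. fps_const (of_rat (a x)) * c x)"
  have van: "fps_nth Q k = 0" if "k < t" for k
  proof -
    have "fps_nth Q k = (\<Sum>x\<in>?J. of_rat (a x) * of_rat (M k x))"
      by (simp add: Q_def fps_sum_nth M)
    also have "\<dots> = of_rat (\<Sum>x\<in>?J. a x * M k x)" by (simp add: of_rat_sum of_rat_mult)
    finally show ?thesis using a(2) that by simp
  qed
  have rad1: "fps_conv_radius (theta_fps L ^ 8) \<ge> 1" for L
    using fps_conv_radius_theta_fps fps_conv_radius_power order_trans by blast
  have rad_pow: "fps_conv_radius ((theta_fps L ^ 8) ^ k) \<ge> 1" for L k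
    using rad1 fps_conv_radius_power order_trans by blast
  have rad_mult: "fps_conv_radius (f * g) \<ge> 1" if "fps_conv_radius f \<ge> 1" "fps_conv_radius g \<ge> 1"
    for f g :: "complex fps"
    using order_trans[OF _ fps_conv_radius_mult[of f g]] that by simp
  have rad_c: "fps_conv_radius (c x) \<ge> 1" for x
    unfolding c_def case_prod_beta by (intro rad_mult rad_pow)
  have rad_ac: "fps_conv_radius (fps_const (of_rat (a x)) * c x) \<ge> 1" for x
    by (intro rad_mult rad_c) simp
  have eval_c: "eval_fps (c (i, j)) w = (eval_fps (theta_fps l) w ^ 8) ^ i *
      (eval_fps (theta_fps m) w ^ 8) ^ j * (eval_fps (theta_fps n) w ^ 8) ^ (d - i - j)"
    if w: "norm w < 1" for w i j
  proof -
    have less: "ereal (norm w) < fps_conv_radius f" if "fps_conv_radius f \<ge> 1" for f :: "complex fps"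
      using w that by (metis ereal_less(3) less_le_trans)
    show ?thesis
      by (simp add: c_def eval_fps_mult eval_fps_power less rad_mult rad_pow rad1 fps_conv_radius_theta_fps)
  qed
  have eval_Q: "eval_fps Q w = homogeneous_form a d (eval_fps (theta_fps l) w ^ 8)
      (eval_fps (theta_fps m) w ^ 8) (eval_fps (theta_fps n) w ^ 8)" if w: "norm w < 1" for w
  proof -
    have less: "ereal (norm w) < fps_conv_radius f" if "fps_conv_radius f \<ge> 1" for f :: "complex fps"
      using w that by (metis ereal_less(3) less_le_trans)
    have "eval_fps Q w = (\<Sum>x\<in>?J. eval_fps (fps_const (of_rat (a x)) * c x) w)"
      unfolding Q_def by (rule conjunct2[OF eval_fps_sum]) (rule less[OF rad_ac])
    also have "\<dots> = (\<Sum>x\<in>?J. of_rat (a x) * eval_fps (c x) w)"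
      by (intro sum.cong refl) (simp add: eval_fps_mult less rad_c)
    also have "\<dots> = homogeneous_form a d (eval_fps (theta_fps l) w ^ 8)
      (eval_fps (theta_fps m) w ^ 8) (eval_fps (theta_fps n) w ^ 8)"
      unfolding homogeneous_form_def by (intro sum.cong refl) (auto simp: eval_c[OF w] mult.assoc)
    finally show ?thesis .
  qed
  \<comment> \<open>\<open>eval_fps_sum\<close> compares the radius with single points only, so a
    point between a smaller radius and 1 is tested.\<close>
  have radQ: "fps_conv_radius Q \<ge> 1"
  proof (rule ccontr)
    assume "\<not> ?thesis"
    then obtain e where e: "fps_conv_radius Q < ereal e" "ereal e < 1"
      using ereal_dense2[of "fps_conv_radius Q" 1] by (auto simp: not_le)
    have e0: "e > 0" using e(1) conv_radius_nonneg[of "fps_nth Q"] unfolding fps_conv_radius_def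
      by (metis ereal_less(2) le_less_trans)
    have "ereal (norm (complex_of_real e)) < fps_conv_radius Q"
      unfolding Q_def
    proof (rule conjunct1[OF eval_fps_sum])
      fix x
      show "ereal (norm (complex_of_real e)) < fps_conv_radius (fps_const (of_rat (a x)) * c x)"
        using less_le_trans[OF e(2) rad_ac] e0 by simp
    qed
    then show False using e(1) e0 by simp
  qed
  \<comment> \<open>The radius exp(-pi/4) is the modulus of the nome at height 1/4.\<close>
  obtain C where C: "\<And>w. norm w \<le> exp (- (pi / 4)) \<Longrightarrow> norm (eval_fps Q w) \<le> C * norm w ^ t"
    using eval_fps_vanishing_bound[OF radQ _ van, of "exp (- (pi / 4))"] by auto
  have "norm (form_of a d (theta3_power l, theta3_power m, theta3_power n) \<tau>) * exp (pi * real t * Im \<tau>) \<le> C"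
    if \<tau>: "Im \<tau> \<ge> 1/4" for \<tau>
  proof -
    have pos: "Im \<tau> > 0" using \<tau> by linarith
    have "form_of a d (theta3_power l, theta3_power m, theta3_power n) \<tau> = eval_fps Q (nome \<tau>)"
      using pos lmn
      by (simp add: form_of_def theta3_power_def theta3_eq_eval_fps eval_Q[OF norm_nome_less_1])
    also have "norm \<dots> \<le> C * norm (nome \<tau>) ^ t"
      using \<tau> by (intro C) (simp add: norm_nome)
    also have "norm (nome \<tau>) ^ t = exp (- (pi * real t * Im \<tau>))"
      unfolding norm_nome by (subst exp_of_nat_mult [symmetric]) (simp add: mult_ac)
    finally show ?thesis by (simp add: exp_minus field_simps)
  qed
  then show ?thesis using a(1) by blast
qed

text \<open>The product of the three full families is used instead of the orbit of one triple:
  stability is inherited componentwise, and \<open>R\<close> bounds the number of functions.\<close>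

lemma form_of_theta3_eq_0:
  fixes l m n :: nat
  assumes lmn: "l \<ge> 1" "m \<ge> 1" "n \<ge> 1"
    and R: "R = card (hecke_family l) * card (hecke_family m) * card (hecke_family n)"
    and t: "t \<ge> 4 * d * R" "t > 0"
    and decay: "\<And>\<tau>. Im \<tau> \<ge> 1/4 \<Longrightarrow>
      norm (form_of a d (theta3_power l, theta3_power m, theta3_power n) \<tau>) * exp (pi * real t * Im \<tau>) \<le> C"
    and \<tau>: "Im \<tau> > 0"
  shows "form_of a d (theta3_power l, theta3_power m, theta3_power n) \<tau> = 0"
proof (rule ccontr)
  define X where "X = hecke_family l \<times> hecke_family m \<times> hecke_family n"
  \<comment> \<open>Discarding the zero functions is essential: a priori, members of other orbits could vanish.\<close>
  define W where "W = {h \<in> form_of a d ` X. \<exists>\<tau>. Im \<tau> > 0 \<and> h \<tau> \<noteq> 0}"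
  define f0 where "f0 = form_of a d (theta3_power l, theta3_power m, theta3_power n)"
  assume "form_of a d (theta3_power l, theta3_power m, theta3_power n) \<tau> \<noteq> 0"
  then have f0: "f0 \<in> W"
    using \<tau> theta3_power_in_hecke_family unfolding W_def X_def f0_def by blast
  have finX: "finite X" using lmn by (simp add: X_def finite_hecke_family)
  have cardX: "card X = R" using R by (simp add: X_def card_cartesian_product)
  have "W \<subseteq> form_of a d ` X" by (auto simp: W_def)
  then have finW: "finite W" and cardW: "card W \<le> R"
    using finX cardX by (auto intro: finite_subset) (metis card_image_le card_mono finite_imageI order_trans)
  have WE: "\<exists>f\<in>hecke_family l. \<exists>g\<in>hecke_family m. \<exists>h\<in>hecke_family n. u = form_of a d (f, g, h)" if "u \<in> W" for u
    using that by (auto simp: W_def X_def)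
  have "\<exists>f\<in>W. \<forall>\<tau>. Im \<tau> > 0 \<longrightarrow> f \<tau> = 0"
  proof (rule slash_closed_family_contains_0[of W "4 * d" f0 t C])
    show "finite W" by (rule finW)
    show "f0 \<in> W" by (rule f0)
    have "4 * d * card W \<le> 4 * d * R" using cardW by (rule mult_left_mono) simp
    then show "t \<ge> 4 * d * card W" using t by linarith
    show "t > 0" by (rule t)
    show "norm (f0 \<tau>) * exp (pi * real t * Im \<tau>) \<le> C" if "Im \<tau> \<ge> 1/4" for \<tau>
      unfolding f0_def by (rule decay[OF that])
    show "\<forall>u\<in>W. \<forall>\<tau>. Im \<tau> \<le> 0 \<longrightarrow> u \<tau> = 0"
      by (auto simp: W_def form_of_def)
    fix u assume u: "u \<in> W"
    obtain f g h where fgh: "f \<in> hecke_family l" "g \<in> hecke_family m" "h \<in> hecke_family n"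
      "u = form_of a d (f, g, h)" using WE[OF u] by blast
    note props = hecke_family_properties[OF fgh(1) lmn(1)] hecke_family_properties[OF fgh(2) lmn(2)]
      hecke_family_properties[OF fgh(3) lmn(3)]
    show "u holomorphic_on upper_half_plane"
      unfolding fgh(4) by (intro holomorphic_form_of props)
    show "\<exists>B. \<forall>\<tau>. Im \<tau> \<ge> 1/4 \<longrightarrow> norm (u \<tau>) \<le> B"
      unfolding fgh(4) by (intro bounded_form_of props)
    obtain \<sigma> where \<sigma>: "Im \<sigma> > 0" "u \<sigma> \<noteq> 0" using u by (auto simp: W_def)
    \<comment> \<open>A nonzero value at \<sigma> reappears at -1/\<sigma> and at \<sigma> - 1, so
      discarding zero functions preserves stability.\<close>
    have "\<sigma> \<noteq> 0" using \<sigma> by auto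
    then have "slash_S (4 * d) u (-1 / \<sigma>) \<noteq> 0"
      using \<sigma> Im_neg_inverse_pos[OF \<sigma>(1)] by (simp add: slash_S_def)
    moreover have "slash_S (4 * d) u \<in> form_of a d ` X"
      unfolding fgh(4) slash_form_of X_def using fgh slash_hecke_family(1) by blast
    ultimately show "slash_S (4 * d) u \<in> W"
      unfolding W_def using Im_neg_inverse_pos[OF \<sigma>(1)] by blast
    have "slash_T u (\<sigma> - 1) \<noteq> 0" "Im (\<sigma> - 1) > 0" using \<sigma> by (simp_all add: slash_T_def)
    moreover have "slash_T u \<in> form_of a d ` X"
      unfolding fgh(4) slash_form_of X_def using fgh slash_hecke_family(2) by blast
    ultimately show "slash_T u \<in> W" unfolding W_def by blast
  qed
  then show False by (auto simp: W_def)
qed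

theorem theorem3:
  fixes \<tau> :: complex and l m n :: nat
  assumes "Im \<tau> > 0"
    and "algebraic (nome \<tau>)"
    and "l \<ge> 1" and "m \<ge> 1" and "n \<ge> 1"
  shows "alg_dependent3 (theta3 (of_nat l * \<tau>)) (theta3 (of_nat m * \<tau>)) (theta3 (of_nat n * \<tau>))"
proof -
  define R where "R = card (hecke_family l) * card (hecke_family m) * card (hecke_family n)"
  have card_pos: "card (hecke_family L) > 0" if "L \<ge> 1" for L
    using theta3_power_in_hecke_family finite_hecke_family[OF that] card_gt_0_iff by blast
  then have R: "R > 0" using assms by (simp add: R_def)
  \<comment> \<open>Two demands meet: t \<ge> 4dR, and t below the number (d + 1)(d + 2)/2 of
    monomials. For d = 8R both 4dR and d^2/2 equal 32 R^2; the lower order terms give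
    strictness.\<close>
  define d where "d = 8 * R"
  define t where "t = 32 * R\<^sup>2"
  have "2 * (t + 1) \<le> (d + 1) * (d + 2)" by (simp add: d_def t_def power2_eq_square algebra_simps)
  then have "t + 1 \<le> (d + 1) * (d + 2) div 2" using div_le_mono[of "2 * (t + 1)" _ 2] by simp
  then have less: "t < (d + 1) * (d + 2) div 2" by simp
  obtain a C x where a: "x \<in> {(i, j). i + j \<le> d}" "a x \<noteq> 0"
    and C: "\<And>\<tau>. Im \<tau> \<ge> 1/4 \<Longrightarrow>
      norm (form_of a d (theta3_power l, theta3_power m, theta3_power n) \<tau>) * exp (pi * real t * Im \<tau>) \<le> C"
    using exists_form_vanishing_at_cusp[OF assms(3-5) less] by blast
  have "form_of a d (theta3_power l, theta3_power m, theta3_power n) \<tau> = 0"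
  proof (rule form_of_theta3_eq_0[OF assms(3-5) R_def _ _ C assms(1)])
    show "t \<ge> 4 * d * R" by (simp add: t_def d_def power2_eq_square)
    show "t > 0" using R by (simp add: t_def)
  qed
  \<comment> \<open>The relation holds between eighth powers; multiplying all exponents by 8 makes
    it one between the values and keeps the triples distinct.\<close>
  then have "(\<Sum>x\<in>{(i, j). i + j \<le> d}. of_rat (a x) * theta3 (of_nat l * \<tau>) ^ (8 * fst x) *
      theta3 (of_nat m * \<tau>) ^ (8 * snd x) * theta3 (of_nat n * \<tau>) ^ (8 * (d - fst x - snd x))) = 0"
    using assms(1)
    by (simp add: form_of_def homogeneous_form_def theta3_power_def case_prod_beta flip: power_mult)
  moreover have "inj_on (\<lambda>x. (8 * fst x, 8 * snd x, 8 * (d - fst x - snd x))) {(i, j). i + j \<le> d}"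
    by (auto simp: inj_on_def)
  ultimately show ?thesis by (intro alg_dependent3I[where a = a, OF finite_triangle _ a])
qed

end
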